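(* Algorithm $\mathcal{A}$ (described in the context) is correct: for every pair of terms $T,T'$ in $\mathsf{Term}_{\triangleright}(x)$, it terminates, returning $\mathtt{true}$ if $T =_{\mathsf{LD}} T'$ holds and $\mathtt{false}$ otherwise. In particular, the word problem of selfdistributivity in the case of one variable is decidable, i.e., there exists an algorithm that, given two terms $T,T'\in\mathsf{Term}_{\triangleright}(x)$, decides whether or not $T =_{\mathsf{LD}} T'$ holds.
   Context: $\mathsf{Term}_{\triangleright}(x)$ is the set of all formal terms built from a single variable $x$ using a binary operation symbol $\triangleright$ (the absolutely free algebra with one binary operation on $\{x\}$), i.e. finite full binary trees. $=_{\mathsf{LD}}$ is the congruence on $\mathsf{Term}_{\triangleright}(x)$ generated by all pairs $(T_1\triangleright(T_2\triangleright T_3),\ (T_1\triangleright T_2)\triangleright(T_1\triangleright T_3))$. An address is a finite sequence of $0$s and $1$s; the subterm $T_{/\alpha}$ of $T$ at address $\alpha$ is obtained by starting from $T$ and successively taking the left subterm for each $0$ and the right subterm for each $1$ (it exists only for some $\alpha$). Applying LD in the expanding direction at address $\alpha$ to $T$ is possible if $T_{/\alpha}$ exists and has the form $T_1\triangleright(T_2\triangleright T_3)$; the result is obtained from $T$ by replacing that subterm by $(T_1\triangleright T_2)\triangleright(T_1\triangleright T_3)$. For a finite sequence $s=(\alpha_1,\dots,\alpha_m)$ of addresses, $\mathrm{EXPAND}(T,s)$ is the term obtained from $T$ by successively applying LD in the expanding direction at $\alpha_1,\dots,\alpha_m$ (it is defined if all steps are possible). For terms $T,T'$, $T\sqsubset^*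 T'$ means that $T$ is a proper iterated left subterm of $T'$, i.e. $T=T'_{/0^r}$ for some $r\ge 1$. Algorithm $\mathcal{A}$: fix a computable exhaustive enumeration $(s_n,s'_n)_{n\ge 0}$ of all pairs of finite sequences of addresses. Input: $T,T'\in \mathsf{Term}_{\triangleright}(x)$. For $n=0,1,2,\dots$: let $T_1:=\mathrm{EXPAND}(T,s_n)$ and $T'_1:=\mathrm{EXPAND}(T',s'_n)$ (if one of these is not defined, go to the next $n$); if $T_1=T'_1$, return $\mathtt{true}$ and stop; if $T_1\sqsubset^* T'_1$ or $T'_1\sqsubset^* T_1$, return $\mathtt{false}$ and stop; otherwise go to the next $n$. *)

theory Defs
  imports "HOL-Library.Nat_Bijection"
begin

subsection \<open>One-variable terms and selfdistributivity\<close>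

datatype ldterm = Var | Op ldterm ldterm  (infix \<open>\<triangleright>\<close> 65)

inductive ld_eq :: "ldterm \<Rightarrow> ldterm \<Rightarrow> bool"  (infix \<open>=\<^sub>L\<^sub>D\<close> 50) where
  ld: "T1 \<triangleright> (T2 \<triangleright> T3) =\<^sub>L\<^sub>D (T1 \<triangleright> T2) \<triangleright> (T1 \<triangleright> T3)"
| refl: "T =\<^sub>L\<^sub>D T"
| sym: "T =\<^sub>L\<^sub>D T' \<Longrightarrow> T' =\<^sub>L\<^sub>D T"
| trans: "T =\<^sub>L\<^sub>D T' \<Longrightarrow> T' =\<^sub>L\<^sub>D T'' \<Longrightarrow> T =\<^sub>L\<^sub>D T''"
| cong: "T1 =\<^sub>L\<^sub>D T1' \<Longrightarrow> T2 =\<^sub>L\<^sub>D T2' \<Longrightarrow> T1 \<triangleright> T2 =\<^sub>L\<^sub>D T1' \<triangleright> T2'"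


subsection \<open>Addresses and expansion\<close>

text \<open>The digit 0 (go to the left subterm) is \<^const>\<open>False\<close>, the digit 1 (go to the right
  subterm) is \<^const>\<open>True\<close>.\<close>

type_synonym address = "bool list"

fun subterm_at :: "ldterm \<Rightarrow> address \<Rightarrow> ldterm option" where
  "subterm_at T [] = Some T"
| "subterm_at Var (d # \<alpha>) = None"
| "subterm_at (T1 \<triangleright> T2) (d # \<alpha>) = subterm_at (if d then T2 else T1) \<alpha>"

text \<open>Only used at addresses where \<^const>\<open>subterm_at\<close> is defined; the value in the second
  equation is arbitrary.\<close>

fun replace_at :: "ldterm \<Rightarrow> address \<Rightarrow> ldterm \<Rightarrow> ldterm" where
  "replace_at T [] U = U"
| "replace_at Var (d # \<alpha>) U = Var"
| "replace_at (T1 \<triangleright> T2) (d # \<alpha>) U =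
     (if d then T1 \<triangleright> replace_at T2 \<alpha> U else replace_at T1 \<alpha> U \<triangleright> T2)"

definition expand_at :: "ldterm \<Rightarrow> address \<Rightarrow> ldterm option" where
  "expand_at T \<alpha> =
     (case subterm_at T \<alpha> of
        Some (T1 \<triangleright> (T2 \<triangleright> T3)) \<Rightarrow> Some (replace_at T \<alpha> ((T1 \<triangleright> T2) \<triangleright> (T1 \<triangleright> T3)))
      | _ \<Rightarrow> None)"

fun EXPAND :: "ldterm \<Rightarrow> address list \<Rightarrow> ldterm option" where
  "EXPAND T [] = Some T"
| "EXPAND T (\<alpha> # s) = Option.bind (expand_at T \<alpha>) (\<lambda>U. EXPAND U s)"

definition iterated_left_subterm :: "ldterm \<Rightarrow> ldterm \<Rightarrow> bool"  (infix \<open>\<sqsubset>\<^sup>*\<close> 50) where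
  "T \<sqsubset>\<^sup>* T' \<longleftrightarrow> (\<exists>r\<ge>1. subterm_at T' (replicate r False) = Some T)"


subsection \<open>The algorithm\<close>

text \<open>The loop, started at index \<open>n\<close>. As a least fixed point over \<^typ>\<open>bool option\<close>,
  the value is \<^const>\<open>None\<close> precisely when the loop does not terminate.\<close>

partial_function (option) algorithm_A_from ::
  "(nat \<Rightarrow> address list \<times> address list) \<Rightarrow> ldterm \<Rightarrow> ldterm \<Rightarrow> nat \<Rightarrow> bool option" where
  "algorithm_A_from enum T T' n =
     (case (EXPAND T (fst (enum n)), EXPAND T' (snd (enum n))) of
        (Some T1, Some T1') \<Rightarrow>
          if T1 = T1' then Some True
          else if T1 \<sqsubset>\<^sup>* T1' \<or> T1' \<sqsubset>\<^sup>* T1 then Some False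
          else algorithm_A_from enum T T' (Suc n)
      | _ \<Rightarrow> algorithm_A_from enum T T' (Suc n))"

definition algorithm_A ::
  "(nat \<Rightarrow> address list \<times> address list) \<Rightarrow> ldterm \<Rightarrow> ldterm \<Rightarrow> bool option" where
  "algorithm_A enum T T' = algorithm_A_from enum T T' 0"


subsection \<open>Computability\<close>

text \<open>Programs for partial recursive functions on the natural numbers. In
  \<open>PrimRec f g\<close> the recursion variable is the first argument, and \<open>g\<close> receives the
  predecessor, the previous value and the parameters, in this order. In \<open>Mu f\<close> the
  variable searched for is the first argument of \<open>f\<close>. Arities are not tracked: a program
  applied to an argument list of unsuitable length may simply have no value.\<close>

datatype recf =
    Zero
  | Succ
  | Proj nat
  | Comp recf "recf list"
  | PrimRec recf recf
  | Mu recf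

inductive computes :: "recf \<Rightarrow> nat list \<Rightarrow> nat \<Rightarrow> bool" where
  zero: "computes Zero xs 0"
| succ: "computes Succ [x] (Suc x)"
| proj: "i < length xs \<Longrightarrow> computes (Proj i) xs (xs ! i)"
| comp: "list_all2 (\<lambda>g y. computes g xs y) gs ys \<Longrightarrow> computes f ys z \<Longrightarrow>
    computes (Comp f gs) xs z"
| primrec_0: "computes f xs y \<Longrightarrow> computes (PrimRec f g) (0 # xs) y"
| primrec_Suc: "computes (PrimRec f g) (n # xs) y \<Longrightarrow> computes g (n # y # xs) z \<Longrightarrow>
    computes (PrimRec f g) (Suc n # xs) z"
| mu: "computes f (n # xs) 0 \<Longrightarrow> (\<forall>k<n. \<exists>y>0. computes f (k # xs) y) \<Longrightarrow>
    computes (Mu f) xs n"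

fun encode_term :: "ldterm \<Rightarrow> nat" where
  "encode_term Var = 0"
| "encode_term (T1 \<triangleright> T2) = Suc (prod_encode (encode_term T1, encode_term T2))"

definition encode_address :: "address \<Rightarrow> nat" where
  "encode_address \<alpha> = list_encode (map of_bool \<alpha>)"

definition encode_addresses :: "address list \<Rightarrow> nat" where
  "encode_addresses s = list_encode (map encode_address s)"

definition computable_enumeration :: "(nat \<Rightarrow> address list \<times> address list) \<Rightarrow> bool" where
  "computable_enumeration enum \<longleftrightarrow>
     (\<exists>p. \<forall>n. computes p [n]
        (prod_encode (encode_addresses (fst (enum n)), encode_addresses (snd (enum n)))))"

definition decidable_relation :: "(ldterm \<Rightarrow> ldterm \<Rightarrow> bool) \<Rightarrow> bool" where
  "decidable_relation R \<longleftrightarrow>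
     (\<exists>p. \<forall>T T'. computes p [encode_term T, encode_term T'] (if R T T' then 1 else 0))"

end

theory Submission
  imports Defs Complex_Main
begin

text \<open>
  The algorithm searches for expansions \<open>U\<close> of \<open>T\<close> and \<open>U'\<close> of \<open>T'\<close> that are equal or such that
  one is a proper iterated left subterm of the other. Its correctness rests on two facts.

  Comparison (\<open>comparison\<close>): such expansions always exist. The right powers
  \<open>x\<^sup>n = x \<triangleright> (x \<triangleright> (\<dots> \<triangleright> x))\<close> with \<open>n\<close> leaves absorb every
  term: \<open>T \<triangleright> x\<^sup>n =\<^sub>L\<^sub>D x\<^sup>n\<^sup>+\<^sup>1\<close> for all large \<open>n\<close>. Hence
  \<open>T \<triangleright> x\<^sup>n\<close> and \<open>T' \<triangleright> x\<^sup>n\<close> are equivalent, and since expansion is confluent they have a common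
  expansion \<open>V\<close>. Expanding a term moves an expansion of each of its iterated left subterms to an
  iterated left subterm, so both \<open>T\<close> and \<open>T'\<close> have expansions on the left spine of \<open>V\<close>, and any two
  subterms on the left spine are comparable. Confluence follows from the full expansion
  \<open>\<partial>T\<close>, an expansion of every one-step expansion of \<open>T\<close> that is monotone for \<open>\<leadsto>\<^sup>*\<close>.

  Acyclicity (\<open>ld_eq_acyclic\<close>): a term is never equivalent to one of its proper iterated left
  subterms, so the answer \<open>false\<close> is right. It suffices to find a selfdistributive structure in which
  \<open>a = (\<dots>(a \<triangleright> b\<^sub>1) \<triangleright> \<dots>) \<triangleright> b\<^sub>r\<close> is impossible. Take the permutations of the set of sequences
  \<open>s\<^sub>0, s\<^sub>1, \<dots>\<close> over a set \<open>Q\<close> with \<open>f \<triangleright> g = f \<circ> shift g \<circ> \<sigma> \<circ> (shift f)\<^sup>-\<^sup>1\<close>, where \<open>\<sigma>\<close> applies a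
  bijective Yang--Baxter map of \<open>Q \<times> Q\<close> to the first two entries and \<open>shift g\<close> applies \<open>g\<close> from the second
  entry on: this is Dehornoy's bracket on braids. A product \<open>(\<dots>(a \<triangleright> b\<^sub>1) \<triangleright> \<dots>) \<triangleright> b\<^sub>r\<close> is
  \<open>a \<circ> g\<close> with \<open>g\<close> composed of at least one \<open>\<sigma>\<close> and of shifted maps. The latter fix the
  first entry. With a Yang--Baxter map that strictly increases a real coordinate of the first entry,
  \<open>g\<close> cannot be the identity. The rational map underlying Dynnikov's action of braids on
  laminations is such a map.

  For decidability, a program searches for a code of formal derivations of two equivalences
  \<open>T =\<^sub>L\<^sub>D U\<close>, \<open>T' =\<^sub>L\<^sub>D U'\<close> together with a depth that witnesses \<open>U = U'\<close>, \<open>U \<sqsubset>\<^sup>* U'\<close>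
  or \<open>U' \<sqsubset>\<^sup>* U\<close>. By the same two facts the search ends and tells which case holds.
\<close>

section \<open>Expansion steps\<close>

inductive ld_step :: "ldterm \<Rightarrow> ldterm \<Rightarrow> bool"  (infix \<open>\<leadsto>\<close> 50) where
  root: "T1 \<triangleright> (T2 \<triangleright> T3) \<leadsto> (T1 \<triangleright> T2) \<triangleright> (T1 \<triangleright> T3)"
| left: "T \<leadsto> T' \<Longrightarrow> T \<triangleright> U \<leadsto> T' \<triangleright> U"
| right: "U \<leadsto> U' \<Longrightarrow> T \<triangleright> U \<leadsto> T \<triangleright> U'"

abbreviation ld_expands :: "ldterm \<Rightarrow> ldterm \<Rightarrow> bool"  (infix \<open>\<leadsto>\<^sup>*\<close> 50) where
  "T \<leadsto>\<^sup>* T' \<equiv> ld_step\<^sup>*\<^sup>* T T'"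

lemma expands_left: "T \<leadsto>\<^sup>* T' \<Longrightarrow> T \<triangleright> U \<leadsto>\<^sup>* T' \<triangleright> U"
  by (induction rule: rtranclp_induct) (auto intro: ld_step.left rtranclp.rtrancl_into_rtrancl)

lemma expands_right: "U \<leadsto>\<^sup>* U' \<Longrightarrow> T \<triangleright> U \<leadsto>\<^sup>* T \<triangleright> U'"
  by (induction rule: rtranclp_induct) (auto intro: ld_step.right rtranclp.rtrancl_into_rtrancl)

lemma expands_cong: "T \<leadsto>\<^sup>* T' \<Longrightarrow> U \<leadsto>\<^sup>* U' \<Longrightarrow> T \<triangleright> U \<leadsto>\<^sup>* T' \<triangleright> U'"
  by (meson expands_left expands_right rtranclp_trans)

lemma ld_step_imp_ld_eq: "T \<leadsto> T' \<Longrightarrow> T =\<^sub>L\<^sub>D T'"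
  by (induction rule: ld_step.induct) (auto intro: ld_eq.intros)

lemma expands_imp_ld_eq: "T \<leadsto>\<^sup>* T' \<Longrightarrow> T =\<^sub>L\<^sub>D T'"
  by (induction rule: rtranclp_induct) (auto intro: ld_eq.intros ld_step_imp_ld_eq)

section \<open>Sequences of addresses as expansions\<close>

lemma expand_at_Cons:
  "expand_at (T1 \<triangleright> T2) (d # \<alpha>) =
    (if d then map_option (\<lambda>U. T1 \<triangleright> U) (expand_at T2 \<alpha>) else map_option (\<lambda>U. U \<triangleright> T2) (expand_at T1 \<alpha>))"
  by (simp add: expand_at_def split: option.split ldterm.split)

lemma expand_at_imp_ld_step: "expand_at T \<alpha> = Some T' \<Longrightarrow> T \<leadsto> T'"
proof (induction T \<alpha> arbitrary: T' rule: subterm_at.induct)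
  case (1 T)
  then show ?case
    by (auto simp: expand_at_def intro: ld_step.root split: ldterm.splits)
next
  case (2 d \<alpha>)
  then show ?case by (simp add: expand_at_def)
next
  case (3 T1 T2 d \<alpha>)
  then show ?case
    by (cases d) (auto simp: expand_at_Cons intro: ld_step.left ld_step.right)
qed

lemma ld_step_imp_expand_at: "T \<leadsto> T' \<Longrightarrow> \<exists>\<alpha>. expand_at T \<alpha> = Some T'"
proof (induction rule: ld_step.induct)
  case (root T1 T2 T3)
  have "expand_at (T1 \<triangleright> (T2 \<triangleright> T3)) [] = Some ((T1 \<triangleright> T2) \<triangleright> (T1 \<triangleright> T3))"
    by (simp add: expand_at_def)
  then show ?case by blast
next
  case (left T T' U)
  then obtain \<alpha> where "expand_at T \<alpha> = Some T'" by blast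
  then have "expand_at (T \<triangleright> U) (False # \<alpha>) = Some (T' \<triangleright> U)" by (simp add: expand_at_Cons)
  then show ?case by blast
next
  case (right U U' T)
  then obtain \<alpha> where "expand_at U \<alpha> = Some U'" by blast
  then have "expand_at (T \<triangleright> U) (True # \<alpha>) = Some (T \<triangleright> U')" by (simp add: expand_at_Cons)
  then show ?case by blast
qed

lemma EXPAND_imp_expands: "EXPAND T s = Some T' \<Longrightarrow> T \<leadsto>\<^sup>* T'"
  by (induction s arbitrary: T)
    (auto simp: bind_eq_Some_conv intro: converse_rtranclp_into_rtranclp expand_at_imp_ld_step)

lemma expands_imp_EXPAND: "T \<leadsto>\<^sup>* T' \<Longrightarrow> \<exists>s. EXPAND T s = Some T'"
proof (induction rule: converse_rtranclp_induct)
  case base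
  have "EXPAND T' [] = Some T'" by simp
  then show ?case by blast
next
  case (step T U)
  then obtain \<alpha> s where "expand_at T \<alpha> = Some U" "EXPAND U s = Some T'"
    using ld_step_imp_expand_at by blast
  then have "EXPAND T (\<alpha> # s) = Some T'" by simp
  then show ?case by blast
qed

section \<open>Confluence of expansion\<close>

text \<open>Distributing \<open>T\<close> over all leaves of \<open>U\<close> is the result of pushing \<open>T\<close> in \<open>T \<triangleright> U\<close> as far
  down as possible.\<close>

fun distr :: "ldterm \<Rightarrow> ldterm \<Rightarrow> ldterm" where
  "distr T Var = T \<triangleright> Var"
| "distr T (U1 \<triangleright> U2) = distr T U1 \<triangleright> distr T U2"

text \<open>Dehornoy's operation \<open>\<partial>\<close>. The three facts \<open>expands_full_expansion\<close>,
  \<open>step_expands_full_expansion\<close> and \<open>full_expansion_step\<close> below make confluence immediate.\<close>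

fun full_expansion :: "ldterm \<Rightarrow> ldterm" where
  "full_expansion Var = Var"
| "full_expansion (T1 \<triangleright> T2) = distr (full_expansion T1) (full_expansion T2)"

lemma op_expands_distr: "T \<triangleright> U \<leadsto>\<^sup>* distr T U"
proof (induction U)
  case (Op U1 U2)
  have "T \<triangleright> (U1 \<triangleright> U2) \<leadsto>\<^sup>* (T \<triangleright> U1) \<triangleright> (T \<triangleright> U2)" by (simp add: ld_step.root r_into_rtranclp)
  then show ?case using expands_cong[OF Op.IH] by (simp add: rtranclp_trans)
qed simp

lemma distr_expands_left: "T \<leadsto>\<^sup>* T' \<Longrightarrow> distr T U \<leadsto>\<^sup>* distr T' U"
  by (induction U) (simp_all add: expands_left expands_cong)

lemma distr_step_right: "U \<leadsto> U' \<Longrightarrow> distr T U \<leadsto> distr T U'"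
  by (induction rule: ld_step.induct) (auto intro: ld_step.intros)

lemma distr_expands_right: "U \<leadsto>\<^sup>* U' \<Longrightarrow> distr T U \<leadsto>\<^sup>* distr T U'"
  by (induction rule: rtranclp_induct) (auto intro: distr_step_right rtranclp.rtrancl_into_rtrancl)

text \<open>The operation \<open>distr\<close> is itself selfdistributive up to expansion. Both sides substitute a term
  for the leaves of \<open>V\<close>, so only a leaf of \<open>V\<close> needs work: there \<open>distr T U\<close> still has to be
  pushed into \<open>T \<triangleright> Var\<close>.\<close>

lemma distr_distr: "distr T (distr U V) \<leadsto>\<^sup>* distr (distr T U) (distr T V)"
proof (induction V)
  case Var
  have "distr T U \<triangleright> (T \<triangleright> Var) \<leadsto>\<^sup>* distr (distr T U) (T \<triangleright> Var)"
    by (rule op_expands_distr)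
  then show ?case by simp
next
  case (Op V1 V2)
  then show ?case by (simp add: expands_cong)
qed

lemma expands_full_expansion: "T \<leadsto>\<^sup>* full_expansion T"
proof (induction T)
  case (Op T U)
  then show ?case
    using rtranclp_trans[OF expands_cong op_expands_distr] by simp
qed simp

text \<open>For a step at the root, writing \<open>A\<close>, \<open>B\<close>, \<open>C\<close> for the full expansions of the three
  subterms, the two copies of \<open>T1\<close> are distributed over \<open>B\<close> and \<open>C\<close>, which gives \<open>A\<close> distributed
  over \<open>B \<triangleright> C\<close>; expanding inside \<open>B \<triangleright> C\<close> completes \<open>\<partial>(T1 \<triangleright> (T2 \<triangleright> T3))\<close>.\<close>

lemma step_expands_full_expansion: "T \<leadsto> T' \<Longrightarrow> T' \<leadsto>\<^sup>* full_expansion T"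
proof (induction rule: ld_step.induct)
  case (root T1 T2 T3)
  let ?A = "full_expansion T1" and ?B = "full_expansion T2" and ?C = "full_expansion T3"
  have "(T1 \<triangleright> T2) \<triangleright> (T1 \<triangleright> T3) \<leadsto>\<^sup>* (?A \<triangleright> ?B) \<triangleright> (?A \<triangleright> ?C)"
    by (intro expands_cong expands_full_expansion)
  also have "\<dots> \<leadsto>\<^sup>* distr ?A ?B \<triangleright> distr ?A ?C"
    by (intro expands_cong op_expands_distr)
  also have "distr ?A ?B \<triangleright> distr ?A ?C = distr ?A (?B \<triangleright> ?C)" by simp
  also have "\<dots> \<leadsto>\<^sup>* distr ?A (distr ?B ?C)"
    by (intro distr_expands_right op_expands_distr)
  finally show ?case by simp
next
  case (left T T' U)
  then show ?case
    using rtranclp_trans[OF expands_cong[OF _ expands_full_expansion] op_expands_distr] by simp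
next
  case (right U U' T)
  then show ?case
    using rtranclp_trans[OF expands_cong[OF expands_full_expansion] op_expands_distr] by simp
qed

lemma full_expansion_step: "T \<leadsto> T' \<Longrightarrow> full_expansion T \<leadsto>\<^sup>* full_expansion T'"
  by (induction rule: ld_step.induct)
    (auto intro: distr_distr distr_expands_left distr_expands_right)

lemma full_expansion_mono: "T \<leadsto>\<^sup>* T' \<Longrightarrow> full_expansion T \<leadsto>\<^sup>* full_expansion T'"
  by (induction rule: rtranclp_induct) (auto intro: full_expansion_step rtranclp_trans)

text \<open>If \<open>T \<leadsto> U\<close> and \<open>T \<leadsto>\<^sup>* V\<close>, then \<open>U \<leadsto>\<^sup>* \<partial>T \<leadsto>\<^sup>* \<partial>V\<close> and \<open>V \<leadsto>\<^sup>* \<partial>V\<close>.\<close>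

lemma expands_strip:
  assumes "T \<leadsto> U" "T \<leadsto>\<^sup>* V"
  shows "\<exists>W. U \<leadsto>\<^sup>* W \<and> V \<leadsto>\<^sup>* W"
proof -
  have "U \<leadsto>\<^sup>* full_expansion V"
    using step_expands_full_expansion[OF assms(1)] full_expansion_mono[OF assms(2)]
    by (rule rtranclp_trans)
  with expands_full_expansion show ?thesis by blast
qed

theorem expands_confluent:
  assumes "T \<leadsto>\<^sup>* U" "T \<leadsto>\<^sup>* V"
  shows "\<exists>W. U \<leadsto>\<^sup>* W \<and> V \<leadsto>\<^sup>* W"
  using assms
proof (induction arbitrary: V rule: converse_rtranclp_induct)
  case base
  then show ?case by blast
next
  case (step T T')
  obtain W where "T' \<leadsto>\<^sup>* W" "V \<leadsto>\<^sup>* W"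
    using expands_strip[OF step.hyps(1) step.prems] by blast
  with step.IH show ?case by (meson rtranclp_trans)
qed

lemma ld_eq_common_expansion: "T =\<^sub>L\<^sub>D T' \<Longrightarrow> \<exists>U. T \<leadsto>\<^sup>* U \<and> T' \<leadsto>\<^sup>* U"
proof (induction rule: ld_eq.induct)
  case (ld T1 T2 T3)
  then show ?case by (meson ld_step.root r_into_rtranclp rtranclp.rtrancl_refl)
next
  case (trans T T' T'')
  then show ?case by (meson expands_confluent rtranclp_trans)
next
  case (cong T1 T1' T2 T2')
  then show ?case by (meson expands_cong)
qed blast+

section \<open>Comparison of terms\<close>

fun right_power :: "nat \<Rightarrow> ldterm" where
  "right_power 0 = Var"
| "right_power (Suc n) = Var \<triangleright> right_power n"

text \<open>For \<open>T \<triangleright> U\<close> one reads selfdistributivity backwards: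
  \<open>(T \<triangleright> U) \<triangleright> x\<^sup>m\<^sup>+\<^sup>1 =\<^sub>L\<^sub>D (T \<triangleright> U) \<triangleright> (T \<triangleright> x\<^sup>m) =\<^sub>L\<^sub>D T \<triangleright> (U \<triangleright> x\<^sup>m) =\<^sub>L\<^sub>D T \<triangleright> x\<^sup>m\<^sup>+\<^sup>1\<close>.
  This is the place where it matters that there is a single variable.
  Note that \<open>right_power n\<close> has \<open>n + 1\<close> leaves.\<close>

lemma absorption: "\<exists>n0. \<forall>n\<ge>n0. T \<triangleright> right_power n =\<^sub>L\<^sub>D right_power (Suc n)"
proof (induction T)
  case Var
  then show ?case by (auto intro: ld_eq.refl)
next
  case (Op T U)
  then obtain k l where k: "\<And>n. n \<ge> k \<Longrightarrow> T \<triangleright> right_power n =\<^sub>L\<^sub>D right_power (Suc n)"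
    and l: "\<And>n. n \<ge> l \<Longrightarrow> U \<triangleright> right_power n =\<^sub>L\<^sub>D right_power (Suc n)" by blast
  have "(T \<triangleright> U) \<triangleright> right_power n =\<^sub>L\<^sub>D right_power (Suc n)" if n: "n \<ge> Suc (max k l)" for n
  proof -
    obtain m where m: "n = Suc m" "m \<ge> k" "m \<ge> l" using n by (cases n) auto
    have "(T \<triangleright> U) \<triangleright> right_power (Suc m) =\<^sub>L\<^sub>D (T \<triangleright> U) \<triangleright> (T \<triangleright> right_power m)"
      using k[OF m(2)] by (auto intro: ld_eq.intros)
    moreover have "(T \<triangleright> U) \<triangleright> (T \<triangleright> right_power m) =\<^sub>L\<^sub>D T \<triangleright> (U \<triangleright> right_power m)"
      by (rule ld_eq.sym[OF ld_eq.ld])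
    moreover have "T \<triangleright> (U \<triangleright> right_power m) =\<^sub>L\<^sub>D T \<triangleright> right_power (Suc m)"
      using l[OF m(3)] by (rule ld_eq.cong[OF ld_eq.refl])
    moreover have "T \<triangleright> right_power (Suc m) =\<^sub>L\<^sub>D right_power (Suc (Suc m))"
      using k[of "Suc m"] m by simp
    ultimately show ?thesis unfolding m(1) by (meson ld_eq.trans)
  qed
  then show ?case by blast
qed

text \<open>A step at the root with \<open>r \<ge> 1\<close> moves the left subterm \<open>U\<close> one level down, unchanged; this is
  why the depth \<open>r'\<close> may grow. Steps inside \<open>U\<close> expand it, and steps off the
  left spine leave it alone.\<close>

lemma left_subterm_step:
  assumes "T \<leadsto> T'" "subterm_at T (replicate r False) = Some U"
  shows "\<exists>r'\<ge>r. \<exists>U'. subterm_at T' (replicate r' False) = Some U' \<and> U \<leadsto>\<^sup>* U'"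
  using assms
proof (induction arbitrary: r rule: ld_step.induct)
  case (root T1 T2 T3)
  show ?case
  proof (cases r)
    case 0
    with root have "U \<leadsto> (T1 \<triangleright> T2) \<triangleright> (T1 \<triangleright> T3)" by (auto intro: ld_step.root)
    with 0 show ?thesis by (intro exI[of _ 0]) auto
  next
    case (Suc m)
    with root show ?thesis by (intro exI[of _ "Suc r"]) auto
  qed
next
  case (left T T' V)
  show ?case
  proof (cases r)
    case 0
    with left show ?thesis by (intro exI[of _ 0]) (auto intro: ld_step.left)
  next
    case (Suc m)
    with left.prems have "subterm_at T (replicate m False) = Some U" by simp
    from left.IH[OF this] obtain r' U' where "r' \<ge> m"
      "subterm_at T' (replicate r' False) = Some U'" "U \<leadsto>\<^sup>* U'" by blast
    with Suc show ?thesis by (intro exI[of _ "Suc r'"]) auto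
  qed
next
  case (right V V' T)
  show ?case
  proof (cases r)
    case 0
    with right show ?thesis by (intro exI[of _ 0]) (auto intro: ld_step.right)
  next
    case (Suc m)
    with right show ?thesis by (intro exI[of _ r]) auto
  qed
qed

lemma left_subterm_expands:
  assumes "T \<leadsto>\<^sup>* T'" "subterm_at T (replicate r False) = Some U"
  shows "\<exists>r' U'. subterm_at T' (replicate r' False) = Some U' \<and> U \<leadsto>\<^sup>* U'"
  using assms
proof (induction arbitrary: r U rule: converse_rtranclp_induct)
  case base
  then show ?case by blast
next
  case (step T S)
  from left_subterm_step[OF step.hyps(1) step.prems] obtain r' U' where
    "subterm_at S (replicate r' False) = Some U'" "U \<leadsto>\<^sup>* U'" by blast
  with step.IH show ?case by (meson rtranclp_trans)
qed

lemma subterm_at_append: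
  "subterm_at T (\<alpha> @ \<beta>) = Option.bind (subterm_at T \<alpha>) (\<lambda>U. subterm_at U \<beta>)"
  by (induction T \<alpha> rule: subterm_at.induct) auto

lemma left_subterms_comparable:
  assumes "subterm_at U (replicate r False) = Some T" "subterm_at U (replicate r' False) = Some T'"
    and "r \<le> r'"
  shows "T = T' \<or> T' \<sqsubset>\<^sup>* T"
proof (cases "r = r'")
  case False
  then obtain k where k: "r' = r + k" "k \<ge> 1" using assms(3)
    by (metis One_nat_def Suc_leI less_eqE not_gr_zero add_0_right)
  have "subterm_at T (replicate k False) = Some T'"
    using assms(1,2) by (simp add: k(1) replicate_add subterm_at_append)
  with k(2) show ?thesis unfolding iterated_left_subterm_def by blast
qed (use assms in simp)

theorem comparison:
  "\<exists>U U'. T \<leadsto>\<^sup>* U \<and> T' \<leadsto>\<^sup>* U' \<and> (U = U' \<or> U \<sqsubset>\<^sup>* U' \<or> U' \<sqsubset>\<^sup>* U)"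
proof -
  obtain k l where "\<And>n. n \<ge> k \<Longrightarrow> T \<triangleright> right_power n =\<^sub>L\<^sub>D right_power (Suc n)"
    and "\<And>n. n \<ge> l \<Longrightarrow> T' \<triangleright> right_power n =\<^sub>L\<^sub>D right_power (Suc n)"
    using absorption by meson
  then have "T \<triangleright> right_power (max k l) =\<^sub>L\<^sub>D T' \<triangleright> right_power (max k l)"
    by (meson ld_eq.sym ld_eq.trans max.cobounded1 max.cobounded2)
  then obtain V where V: "T \<triangleright> right_power (max k l) \<leadsto>\<^sup>* V" "T' \<triangleright> right_power (max k l) \<leadsto>\<^sup>* V"
    using ld_eq_common_expansion by blast
  obtain r U r' U' where "subterm_at V (replicate r False) = Some U" "T \<leadsto>\<^sup>* U"
    and "subterm_at V (replicate r' False) = Some U'" "T' \<leadsto>\<^sup>* U'"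
    using left_subterm_expands[OF V(1), of 1 T] left_subterm_expands[OF V(2), of 1 T'] by auto
  with left_subterms_comparable show ?thesis by (metis nle_le)
qed

section \<open>A Yang--Baxter map on pairs of positive reals\<close>

text \<open>For \<open>x, y, u, v > 0\<close> the image \<open>((X, Y), (U, V))\<close> of \<open>(x, y), (u, v)\<close> is the solution of
  the equations in \<open>dynnikov_eqI\<close>, which are easier to work with than the explicit formulas. Replacing
  addition, multiplication and division by maximum, addition and subtraction gives, up to
  conventions, Dynnikov's piecewise linear formulas for the action of a braid generator on the
  coordinates of a lamination. The rational form is preferred here: the braid relation becomes an identity of
  rational functions instead of a large case distinction, and \<open>x < X\<close> holds strictly.\<close>

fun dynnikov :: "real \<times> real \<Rightarrow> real \<times> real \<Rightarrow> (real \<times> real) \<times> (real \<times> real)" where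
  "dynnikov (x, y) (u, v) =
     (let p = x * (1 + y); w = y + p * (1 + v) / u in ((p + u * y, y * v / w), (p * v / (1 + w), w)))"

declare dynnikov.simps [simp del]

lemma dynnikov_eqI:
  assumes "0 < u" "0 < V"
    and "X = x * (1 + y) + u * y" "u * V = X + x * (1 + y) * v" "Y * V = y * v"
      "U * (1 + V) = x * (1 + y) * v"
  shows "dynnikov (x, y) (u, v) = ((X, Y), (U, V))"
proof -
  have V: "y + x * (1 + y) * (1 + v) / u = V"
    using assms by (simp add: field_simps)
  have "Y = y * v / V" "U = x * (1 + y) * v / (1 + V)"
    using assms by (simp_all add: eq_divide_eq)
  then show ?thesis using assms(3) by (simp add: dynnikov.simps Let_def V del: times_divide_eq_left times_divide_eq_right)
qed

lemma dynnikov_pos_cases: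
  assumes "0 < x" "0 < y" "0 < u" "0 < v"
  obtains X Y U V where "dynnikov (x, y) (u, v) = ((X, Y), (U, V))" "0 < X" "0 < Y" "0 < U" "0 < V"
    "X = x * (1 + y) + u * y" "u * V = X + x * (1 + y) * v" "Y * V = y * v"
    "U * (1 + V) = x * (1 + y) * v"
proof -
  define p V where "p = x * (1 + y)" and "V = y + p * (1 + v) / u"
  have pos: "0 < p" "0 < V" using assms by (simp_all add: p_def V_def add_pos_pos)
  show ?thesis
  proof (rule that)
    show "dynnikov (x, y) (u, v) = ((p + u * y, y * v / V), (p * v / (1 + V), V))"
      by (simp add: dynnikov.simps p_def V_def Let_def)
    show "p + u * y = x * (1 + y) + u * y" by (simp add: p_def)
    show "u * V = p + u * y + x * (1 + y) * v"
      using assms(3) by (simp add: V_def p_def [symmetric] field_simps)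
    show "p * v / (1 + V) * (1 + V) = x * (1 + y) * v"
      using pos by (simp add: p_def [symmetric])
  qed (use assms pos in \<open>simp_all add: add_pos_pos\<close>)
qed

text \<open>The equations determine \<open>(x, y), (u, v)\<close> as well: put \<open>q = U (1 + V) = x (1 + y) v\<close>; then
  \<open>u = (X + q) / V\<close>, \<open>v = (q + (X + q) Y) / X\<close>, \<open>y = Y V / v\<close> and \<open>x = q / (v (1 + y))\<close>.\<close>

lemma dynnikov_inj:
  assumes pos: "0 < x" "0 < y" "0 < u" "0 < v" "0 < x'" "0 < y'" "0 < u'" "0 < v'"
    and eq: "dynnikov (x, y) (u, v) = dynnikov (x', y') (u', v')"
  shows "(x, y) = (x', y') \<and> (u, v) = (u', v')"
proof -
  obtain X Y U V where d: "dynnikov (x, y) (u, v) = ((X, Y), (U, V))" "0 < X" "0 < Y" "0 < U" "0 < V"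
    and e: "X = x * (1 + y) + u * y" "u * V = X + x * (1 + y) * v" "Y * V = y * v"
    "U * (1 + V) = x * (1 + y) * v"
    using dynnikov_pos_cases[OF pos(1-4)] .
  obtain X' Y' U' V' where d': "dynnikov (x', y') (u', v') = ((X', Y'), (U', V'))"
    and e': "X' = x' * (1 + y') + u' * y'" "u' * V' = X' + x' * (1 + y') * v'" "Y' * V' = y' * v'"
    "U' * (1 + V') = x' * (1 + y') * v'"
    using dynnikov_pos_cases[OF pos(5-8)] .
  have "X' = X" "Y' = Y" "U' = U" "V' = V" using d d' eq by simp_all
  note e' = e'[unfolded this]
  have u: "u = u'" using e(2) e'(2) \<open>0 < V\<close> unfolding e(4)[symmetric] e'(4)[symmetric]
    by (metis less_irrefl mult_right_cancel)
  have "X * v = U * (1 + V) + u * (Y * V)" unfolding e(3,4) e(1) by (simp add: algebra_simps)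
  also have "\<dots> = X * v'" unfolding e'(3,4) u e'(1) by (simp add: algebra_simps)
  finally have v: "v = v'" using \<open>0 < X\<close> by simp
  have y: "y = y'" using e(3) e'(3) v pos by simp
  have "x = x'" using e(4) e'(4) v y pos by simp
  with u v y show ?thesis by simp
qed

lemma dynnikov_surj:
  assumes "0 < X" "0 < Y" "0 < U" "0 < V"
  obtains x y u v where "0 < x" "0 < y" "0 < u" "0 < v" "dynnikov (x, y) (u, v) = ((X, Y), (U, V))"
proof -
  define q u where "q = U * (1 + V)" and "u = (X + q) / V"
  define v where "v = (q + u * V * Y) / X"
  define y where "y = Y * V / v"
  define x where "x = q / v / (1 + y)"
  have pos: "0 < q" "0 < u" "0 < v" "0 < y" "0 < x"
    using assms by (simp_all add: q_def u_def v_def y_def x_def add_pos_pos)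
  have uV: "u * V = X + q" using assms by (simp add: u_def)
  have Xv: "X * v = q + u * V * Y" using assms by (simp add: v_def)
  have yv: "Y * V = y * v" using pos by (simp add: y_def)
  have p: "x * (1 + y) = q / v" using pos by (simp add: x_def)
  have q: "x * (1 + y) * v = q" using pos unfolding p by simp
  have "(x * (1 + y) + u * y) * v = q + u * (Y * V)" unfolding yv q [symmetric] by (simp add: algebra_simps)
  also have "\<dots> = X * v" using Xv by simp
  finally have X: "X = x * (1 + y) + u * y" using pos by simp
  show ?thesis
  proof (rule that [OF _ _ _ _ dynnikov_eqI])
    show "u * V = X + x * (1 + y) * v" "U * (1 + V) = x * (1 + y) * v"
      by (simp_all only: q uV, simp only: q_def)
    show "X = x * (1 + y) + u * y" by (fact X)
    show "Y * V = y * v" by (fact yv)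
  qed (use pos assms in simp_all)
qed

text \<open>The Yang--Baxter equation: applying the map to entries 1 and 2, then 2 and 3, then 1 and 2 of a
  triple gives the same as starting with entries 2 and 3. Naming the polynomials that occur in
  the intermediate values makes all denominators monomials. Each of the six applications then
  amounts to clearing denominators and to the polynomial identities \<open>k1\<close> to \<open>k8\<close>, which are
  what makes common factors cancel.\<close>

lemma dynnikov_yang_baxter:
  assumes "0 < x" "0 < y" "0 < u" "0 < v" "0 < a" "0 < b"
  obtains P1 Q1 P Q Q2 R q1 r1 q2
  where "dynnikov (x, y) (u, v) = (P1, Q1)" "dynnikov Q1 (a, b) = (Q2, R)" "dynnikov P1 Q2 = (P, Q)"
    "dynnikov (u, v) (a, b) = (q1, r1)" "dynnikov (x, y) q1 = (P, q2)" "dynnikov q2 r1 = (Q, R)"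
proof -
  define p where "p = x * (1 + y)"
  define X where "X = p + u * y"
  define N where "N = p * (1 + v) + u * y"
  define e where "e = a + u * (1 + b)"
  define w where "w = u * (1 + v) + a * v"
  define n where "n = w + u * (1 + v) * b"
  define M where "M = p * v * u * (1 + b) + a * N"
  define W where "W = y * n + p * (1 + b)"
  define S where "S = p * v * u + a * N"
  define D where "D = u + N"
  define A where "A = M + a * u"
  define F where "F = n + W"
  note defs = A_def D_def F_def S_def W_def M_def n_def w_def e_def N_def X_def
  have pos: "0 < p" "0 < X" "0 < N" "0 < e" "0 < w" "0 < n" "0 < M" "0 < W" "0 < S" "0 < D" "0 < A" "0 < F"
    unfolding defs p_def
    using assms(1-6) by (simp_all add: add_pos_pos)
  note pos' = pos assms(1-6)
  have k1: "N + y * v * u = (1 + v) * X"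
   and k2: "(p + w * y) * M + (1 + v) * X\<^sup>2 * b * a = W * S"
   and k3: "(1 + v) * X\<^sup>2 + S * y * v = (p + w * y) * N"
   and k4: "M + W * u = (1 + v) * X * e"
   and k5: "p * v * e + u * W = n * X"
   and k6: "a + n = (1 + v) * e"
   and k7: "(p + w * y) * n + p * (v * b * a) = w * W"
   and k8: "p * v * e + X * a = M"
    by (simp_all add: defs power2_eq_square algebra_simps)
  have 1: "dynnikov (x, y) (u, v) = ((X, y * v * u / N), (p * v * u / D, N / u))"
    by (rule dynnikov_eqI; (unfold p_def [symmetric])?)
      (use pos' in \<open>simp_all add: X_def field_simps\<close>, simp_all add: N_def D_def field_simps)
  have 2: "dynnikov (p * v * u / D, N / u) (a, b) = ((S / u, N * b * a / M), (p * v * b * a * u / A, M / (a * u)))"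
    by (rule dynnikov_eqI)
      (use pos' in \<open>simp_all add: field_simps\<close>, simp_all add: S_def M_def A_def D_def field_simps)
  have "X * (1 + y * v * u / N) = X * (N + y * v * u) / N"
    using pos' by (simp add: field_simps)
  also have "\<dots> = (1 + v) * X\<^sup>2 / N" unfolding k1 by (simp add: power2_eq_square)
  finally have X1: "X * (1 + y * v * u / N) = (1 + v) * X\<^sup>2 / N" .
  have 3: "dynnikov (X, y * v * u / N) (S / u, N * b * a / M) = ((p + w * y, y * v * b * a / W), (X * b * a / e, W * u / M))"
  proof (rule dynnikov_eqI, unfold X1)
    show "p + w * y = (1 + v) * X\<^sup>2 / N + S / u * (y * v * u / N)"
       using pos' k3 by (simp add: field_simps)
    have "p + w * y + (1 + v) * X\<^sup>2 / N * (N * b * a / M) = ((p + w * y) * M + (1 + v) * X\<^sup>2 * b * a) / M"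
      using pos' by (simp add: add_divide_distrib)
    also have "\<dots> = S / u * (W * u / M)"
      unfolding k2 using pos' by simp
    finally show "S / u * (W * u / M) = p + w * y + (1 + v) * X\<^sup>2 / N * (N * b * a / M)" ..
    have "X * b * a / e * (1 + W * u / M) = X * b * a / e * (M + W * u) / M"
      using pos' by (simp add: field_simps)
    also have "\<dots> = (1 + v) * X\<^sup>2 / N * (N * b * a / M)" unfolding k4 using pos' by (simp add: power2_eq_square)
    finally show "X * b * a / e * (1 + W * u / M) = (1 + v) * X\<^sup>2 / N * (N * b * a / M)" .
  qed (use pos' in simp_all)
  have 4: "dynnikov (u, v) (a, b) = ((w, v * b * a / n), (a * u * b / e, n / a))"
  proof (rule dynnikov_eqI)
    have "a * u * b / e * (1 + n / a) = u * b / e * (a + n)"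
      using pos' by (simp add: field_simps)
    also have "\<dots> = u * (1 + v) * b" unfolding k6 using pos' by simp
    finally show "a * u * b / e * (1 + n / a) = u * (1 + v) * b" .
  qed (use pos' in \<open>simp_all add: w_def n_def\<close>)
  have X2: "p * v * b * a / F * (1 + W / n) = p * v * b * a / n"
    using pos' by (simp add: field_simps) (simp add: F_def algebra_simps)
  have 5: "dynnikov (x, y) (w, v * b * a / n) = ((p + w * y, y * v * b * a / W), (p * v * b * a / F, W / n))"
  proof (rule dynnikov_eqI, unfold X2 p_def [symmetric])
    have "p + w * y + p * (v * b * a / n) = ((p + w * y) * n + p * (v * b * a)) / n"
      using pos' by (simp add: add_divide_distrib)
    also have "\<dots> = w * (W / n)" unfolding k7 by simp
    finally show "w * (W / n) = p + w * y + p * (v * b * a / n)" ..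
  qed (use pos' in simp_all)
  have 6: "dynnikov (p * v * b * a / F, W / n) (a * u * b / e, n / a) =
     ((X * b * a / e, W * u / M), (p * v * b * a * u / A, M / (a * u)))"
  proof (rule dynnikov_eqI, unfold X2)
    have "p * v * b * a / n + a * u * b / e * (W / n) = (p * v * e + u * W) * (b * a) / (n * e)"
      using pos' by (simp add: field_simps)
    also have "\<dots> = X * b * a / e" unfolding k5 using pos' by simp
    finally show "X * b * a / e = p * v * b * a / n + a * u * b / e * (W / n)" ..
    have "X * b * a / e + p * v * b = (p * v * e + X * a) * b / e"
      using pos' by (simp add: field_simps)
    also have "\<dots> = b * M / e" unfolding k8 using pos' by simp
    finally show "a * u * b / e * (M / (a * u)) = X * b * a / e + p * v * b * a / n * (n / a)"
      using pos' by (simp add: mult.commute)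
    show "p * v * b * a * u / A * (1 + M / (a * u)) = p * v * b * a / n * (n / a)"
      using pos' by (simp add: field_simps) (simp add: A_def algebra_simps)
  qed (use pos' in simp_all)
  show ?thesis by (rule that) (fact 1 2 3 4 5 6)+
qed

text \<open>Conjugation with the exponential function carries the map from pairs of positive reals to all
  of \<open>\<real>\<^sup>2\<close>, so that sequences of arbitrary entries can be acted on.\<close>

abbreviation pos2 :: "real \<times> real \<Rightarrow> bool" where
  "pos2 p \<equiv> 0 < fst p \<and> 0 < snd p"

definition exp2 :: "real \<times> real \<Rightarrow> real \<times> real" where
  "exp2 = map_prod exp exp"

definition ln2 :: "real \<times> real \<Rightarrow> real \<times> real" where
  "ln2 = map_prod ln ln"

lemma exp2_simps [simp]: "pos2 (exp2 p)" "ln2 (exp2 p) = p" "pos2 p \<Longrightarrow> exp2 (ln2 p) = p"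
  by (cases p; simp add: exp2_def ln2_def)+

definition switch :: "real \<times> real \<Rightarrow> real \<times> real \<Rightarrow> (real \<times> real) \<times> (real \<times> real)" where
  "switch p q = map_prod ln2 ln2 (dynnikov (exp2 p) (exp2 q))"

lemma dynnikov_pos:
  assumes "pos2 p" "pos2 q" "dynnikov p q = (P, Q)"
  shows "pos2 P" "pos2 Q" "fst p < fst P"
proof -
  obtain x y u v where pq: "p = (x, y)" "q = (u, v)" by (metis surj_pair)
  have pos: "0 < x" "0 < y" "0 < u" "0 < v" using assms pq by simp_all
  obtain X Y U V where "dynnikov (x, y) (u, v) = ((X, Y), (U, V))" "0 < X" "0 < Y" "0 < U" "0 < V"
    and X: "X = x * (1 + y) + u * y"
    using dynnikov_pos_cases[OF pos] .
  moreover have "x < X" using pos by (simp add: X algebra_simps add_pos_pos)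
  ultimately have "pos2 P \<and> pos2 Q \<and> fst p < fst P"
    using assms(3) pq by auto
  then show "pos2 P" "pos2 Q" "fst p < fst P" by simp_all
qed

lemma switch_eq: "switch p q = (ln2 P, ln2 Q)" "pos2 P" "pos2 Q" if "dynnikov (exp2 p) (exp2 q) = (P, Q)"
  using that dynnikov_pos[OF _ _ that] by (simp_all add: switch_def)

lemma switch_bij: "bij (case_prod switch)"
proof (rule bijI')
  fix r r' :: "(real \<times> real) \<times> (real \<times> real)"
  obtain p q p' q' where r: "r = (p, q)" "r' = (p', q')" by (metis surj_pair)
  obtain P Q P' Q' where d: "dynnikov (exp2 p) (exp2 q) = (P, Q)" "dynnikov (exp2 p') (exp2 q') = (P', Q')"
    by (metis surj_pair)
  show "case_prod switch r = case_prod switch r' \<longleftrightarrow> r = r'"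
  proof
    assume "case_prod switch r = case_prod switch r'"
    then have "(P, Q) = (P', Q')"
      using switch_eq[OF d(1)] switch_eq[OF d(2)] r by (metis case_prod_conv exp2_simps(3) prod.inject)
    then have "dynnikov (fst (exp2 p), snd (exp2 p)) (fst (exp2 q), snd (exp2 q)) =
        dynnikov (fst (exp2 p'), snd (exp2 p')) (fst (exp2 q'), snd (exp2 q'))"
      using d by simp
    from dynnikov_inj[OF _ _ _ _ _ _ _ _ this] have "exp2 p = exp2 p' \<and> exp2 q = exp2 q'"
      by simp
    then show "r = r'" using r by (metis exp2_simps(2))
  qed simp
next
  fix R :: "(real \<times> real) \<times> (real \<times> real)"
  obtain P Q where R: "R = (P, Q)" by (metis surj_pair)
  obtain x y u v where "0 < x" "0 < y" "0 < u" "0 < v"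
    "dynnikov (x, y) (u, v) = ((fst (exp2 P), snd (exp2 P)), (fst (exp2 Q), snd (exp2 Q)))"
    using dynnikov_surj[of "fst (exp2 P)" "snd (exp2 P)" "fst (exp2 Q)" "snd (exp2 Q)"]
    by (metis exp2_simps(1))
  then have "switch (ln2 (x, y)) (ln2 (u, v)) = R"
    by (simp add: switch_def R)
  then show "\<exists>r. R = case_prod switch r" by (metis case_prod_conv)
qed

lemma switch_increasing: "fst p < fst (fst (switch p q))"
proof -
  obtain P Q where d: "dynnikov (exp2 p) (exp2 q) = (P, Q)" by (metis surj_pair)
  have "fst (exp2 p) < fst P" "pos2 P" using dynnikov_pos[OF _ _ d] by simp_all
  then show ?thesis
    unfolding switch_eq(1)[OF d]
    by (cases p; cases P) (simp add: exp2_def ln2_def, metis exp_less_cancel_iff exp_ln)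
qed

lemma switch_yang_baxter:
  obtains p1 q1 p q q2 r q1' r1 q2'
  where "switch x y = (p1, q1)" "switch q1 z = (q2, r)" "switch p1 q2 = (p, q)"
    "switch y z = (q1', r1)" "switch x q1' = (p, q2')" "switch q2' r1 = (q, r)"
proof -
  obtain P1 Q1 P Q Q2 R Q1' R1 Q2' where
    d: "dynnikov (exp2 x) (exp2 y) = (P1, Q1)" "dynnikov Q1 (exp2 z) = (Q2, R)" "dynnikov P1 Q2 = (P, Q)"
      "dynnikov (exp2 y) (exp2 z) = (Q1', R1)" "dynnikov (exp2 x) Q1' = (P, Q2')" "dynnikov Q2' R1 = (Q, R)"
    by (rule dynnikov_yang_baxter[of "fst (exp2 x)" "snd (exp2 x)" "fst (exp2 y)" "snd (exp2 y)"
        "fst (exp2 z)" "snd (exp2 z)"]) (use exp2_simps(1) in simp_all)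
  have pos: "pos2 P1" "pos2 Q1" "pos2 Q1'" "pos2 R1"
    using dynnikov_pos[OF _ _ d(1)] dynnikov_pos[OF _ _ d(4)] by simp_all
  have pos': "pos2 Q2" "pos2 Q2'"
    using dynnikov_pos[OF _ _ d(2)] dynnikov_pos[OF _ _ d(5)] pos by simp_all
  show ?thesis
    by (rule that [of "ln2 P1" "ln2 Q1" "ln2 Q2" "ln2 R" "ln2 P" "ln2 Q" "ln2 Q1'" "ln2 R1" "ln2 Q2'"];
        unfold switch_def; simp only: pos pos' d exp2_simps map_prod_simp)
qed

section \<open>The braid generators as permutations of sequences\<close>

type_synonym state = "nat \<Rightarrow> real \<times> real"

text \<open>A map \<open>f\<close> on sequences gives \<open>shift f\<close>, which keeps the first entry and applies \<open>f\<close> to the others.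
  The maps \<open>sigma1\<close>, \<open>shift sigma1\<close>, \<open>shift (shift sigma1)\<close>, \<dots> satisfy the relations of the braid generators
  \<open>\<sigma>\<^sub>1\<close>, \<open>\<sigma>\<^sub>2\<close>, \<open>\<sigma>\<^sub>3\<close>, \<dots>; the two that matter are \<open>sigma1_commutes\<close> and \<open>sigma1_braid\<close>.\<close>

definition sigma1 :: "state \<Rightarrow> state" where
  "sigma1 s = (case switch (s 0) (s 1) of (p, q) \<Rightarrow> s(0 := p, 1 := q))"

definition shift :: "(state \<Rightarrow> state) \<Rightarrow> state \<Rightarrow> state" where
  "shift f s = case_nat (s 0) (f (\<lambda>n. s (Suc n)))"

lemma shift_0 [simp]: "shift f s 0 = s 0"
  and shift_Suc [simp]: "(\<lambda>n. shift f s (Suc n)) = f (\<lambda>n. s (Suc n))"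
  by (simp_all add: shift_def)

lemma state_eqI: "s 0 = t 0 \<Longrightarrow> (\<lambda>n. s (Suc n)) = (\<lambda>n. t (Suc n)) \<Longrightarrow> s = (t :: state)"
proof
  fix n assume "s 0 = t 0" "(\<lambda>n. s (Suc n)) = (\<lambda>n. t (Suc n))"
  then show "s n = t n" by (cases n) (auto dest: fun_cong)
qed

lemma shift_comp: "shift f (shift g s) = shift (\<lambda>s. f (g s)) s"
  by (simp add: shift_def)

lemma shift_id [simp]: "shift (\<lambda>s. s) s = s"
  by (rule state_eqI) simp_all

lemma bij_shift: assumes "bij f" shows "bij (shift f)"
proof (rule o_bij)
  show "shift (inv f) \<circ> shift f = id" "shift f \<circ> shift (inv f) = id"
    using assms by (auto intro!: ext [where f = "_ \<circ> _"] simp: shift_comp bij_is_inj bij_is_surj surj_f_inv_f)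
qed

lemma sigma1_tail: "(\<lambda>n. sigma1 s (Suc (Suc n))) = (\<lambda>n. s (Suc (Suc n)))"
  by (simp add: sigma1_def split: prod.split)

lemma sigma1_heads: "sigma1 s 0 = fst (switch (s 0) (s 1))" "sigma1 s 1 = snd (switch (s 0) (s 1))"
  by (simp_all add: sigma1_def split: prod.split)

lemma state_eqI2:
  "s 0 = t 0 \<Longrightarrow> s 1 = t 1 \<Longrightarrow> (\<lambda>n. s (Suc (Suc n))) = (\<lambda>n. t (Suc (Suc n))) \<Longrightarrow> s = (t :: state)"
  by (rule state_eqI, simp, rule state_eqI) simp_all

lemma sigma1_commutes: "sigma1 (shift (shift f) s) = shift (shift f) (sigma1 s)"
proof (rule state_eqI2)
  have "shift (shift f) t (Suc 0) = t (Suc 0)" for t by (simp add: shift_def)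
  then show "sigma1 (shift (shift f) s) 0 = shift (shift f) (sigma1 s) 0" "sigma1 (shift (shift f) s) 1 = shift (shift f) (sigma1 s) 1"
    using sigma1_heads[of s] sigma1_heads[of "shift (shift f) s"] by simp_all
  have tail: "(\<lambda>n. shift (shift f) t (Suc (Suc n))) = f (\<lambda>n. t (Suc (Suc n)))" for t
    by (simp add: shift_def)
  show "(\<lambda>n. sigma1 (shift (shift f) s) (Suc (Suc n))) = (\<lambda>n. shift (shift f) (sigma1 s) (Suc (Suc n)))"
    unfolding sigma1_tail tail ..
qed

lemma sigma1_braid: "sigma1 (shift sigma1 (sigma1 s)) = shift sigma1 (sigma1 (shift sigma1 s))"
proof -
  obtain p1 q1 p q q2 r q1' r1 q2'
  where sw: "switch (s 0) (s 1) = (p1, q1)" "switch q1 (s 2) = (q2, r)" "switch p1 q2 = (p, q)"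
    "switch (s 1) (s 2) = (q1', r1)" "switch (s 0) q1' = (p, q2')" "switch q2' r1 = (q, r)"
    by (rule switch_yang_baxter)
  show ?thesis
  proof
    fix n
    consider "n = 0" | "n = 1" | "n = 2" | m where "n = Suc (Suc (Suc m))"
      by (metis One_nat_def nat.exhaust numeral_2_eq_2)
    then show "sigma1 (shift sigma1 (sigma1 s)) n = shift sigma1 (sigma1 (shift sigma1 s)) n"
      by cases (simp_all add: sigma1_def shift_def sw [unfolded One_nat_def numeral_2_eq_2] numeral_2_eq_2)
  qed
qed

lemma bij_sigma1: "bij sigma1"
proof -
  define switch_back :: "state \<Rightarrow> state" where
    "switch_back s = (case inv (case_prod switch) (s 0, s 1) of (p, q) \<Rightarrow> s(0 := p, 1 := q))" for s
  have 1: "switch_back (sigma1 s) = s" for s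
  proof -
    obtain p q where sw: "switch (s 0) (s 1) = (p, q)" by (metis surj_pair)
    then have "inv (case_prod switch) (p, q) = (s 0, s 1)"
      using inv_f_f[OF bij_is_inj[OF switch_bij], of "(s 0, s 1)"] by simp
    then show ?thesis using sw by (simp add: switch_back_def sigma1_def fun_eq_iff)
  qed
  have 2: "sigma1 (switch_back s) = s" for s
  proof -
    obtain p q where inv: "inv (case_prod switch) (s 0, s 1) = (p, q)" by (metis surj_pair)
    then have "switch p q = (s 0, s 1)"
      using surj_f_inv_f[OF bij_is_surj[OF switch_bij], of "(s 0, s 1)"] by simp
    then show ?thesis using inv by (simp add: switch_back_def sigma1_def fun_eq_iff)
  qed
  show ?thesis
  proof (rule o_bij)
    show "switch_back \<circ> sigma1 = id" by (rule ext) (simp add: 1)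
    show "sigma1 \<circ> switch_back = id" by (rule ext) (simp add: 2)
  qed
qed

lemma sigma1_increasing: "fst (s 0) < fst (sigma1 s 0)"
  by (simp add: sigma1_heads switch_increasing)

section \<open>Selfdistributivity of the shifted conjugation bracket\<close>

definition bracket :: "(state \<Rightarrow> state) \<Rightarrow> (state \<Rightarrow> state) \<Rightarrow> state \<Rightarrow> state" where
  "bracket f g = f \<circ> shift g \<circ> sigma1 \<circ> inv (shift f)"

lemma bij_bracket: "bij f \<Longrightarrow> bij g \<Longrightarrow> bij (bracket f g)"
  unfolding bracket_def by (intro bij_comp bij_shift bij_sigma1 bij_imp_bij_inv)

lemma bracket_shift: "bij f \<Longrightarrow> bracket f g (shift f s) = f (shift g (sigma1 s))"
  by (simp add: bracket_def inv_f_f bij_is_inj bij_shift)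

text \<open>On states in the image of \<open>shift f\<close> the inverse in the bracket disappears: \<open>bracket_shift\<close> reads
  \<open>k \<circ> shift f = f \<circ> shift g \<circ> \<sigma>\<^sub>1\<close> for \<open>k = f \<triangleright> g\<close>. Therefore both sides of selfdistributivity are
  evaluated at \<open>shift k (shift (shift f) t)\<close>. Pushing the shifted maps through with \<open>sigma1_commutes\<close>
  leaves \<open>f \<circ> shift g \<circ> shift (shift h)\<close> followed on the right by \<open>\<sigma>\<^sub>2\<sigma>\<^sub>1\<sigma>\<^sub>2\<close> on one side and by
  \<open>\<sigma>\<^sub>1\<sigma>\<^sub>2\<sigma>\<^sub>1\<close> on the other.\<close>

lemma bracket_selfdistributive:
  assumes f: "bij f" and g: "bij g" and h: "bij h"
  shows "bracket f (bracket g h) = bracket (bracket f g) (bracket f h)"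
proof
  fix s
  let ?k = "bracket f g" and ?l = "bracket f h" and ?m = "bracket g h"
  have "surj (\<lambda>s. shift ?k (shift (shift f) s))"
    using bij_comp[OF bij_shift[OF bij_shift[OF f]] bij_shift[OF bij_bracket[OF f g]]]
    by (simp add: bij_is_surj comp_def)
  then obtain t where s: "s = shift ?k (shift (shift f) t)" by (metis surjD)
  have k: "shift ?k (shift (shift f) t) = shift f (shift (shift g) (shift sigma1 t))"
    by (simp add: shift_comp bracket_shift f)
  have l: "shift ?l (shift (shift f) t) = shift f (shift (shift h) (shift sigma1 t))" for t
    by (simp add: shift_comp bracket_shift f)
  have m: "shift ?m (shift (shift g) t) = shift g (shift (shift h) (shift sigma1 t))" for t
    by (simp add: shift_comp bracket_shift g)
  have "bracket f ?m s = f (shift ?m (sigma1 (shift (shift g) (shift sigma1 t))))"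
    unfolding s k by (rule bracket_shift[OF f])
  also have "\<dots> = f (shift g (shift (shift h) (shift sigma1 (sigma1 (shift sigma1 t)))))"
    by (simp only: sigma1_commutes m)
  also have "\<dots> = f (shift g (sigma1 (shift (shift h) (shift sigma1 (sigma1 t)))))"
    by (simp only: sigma1_commutes sigma1_braid)
  also have "\<dots> = ?k (shift ?l (sigma1 (shift (shift f) t)))"
    by (simp only: sigma1_commutes l bracket_shift f)
  also have "\<dots> = bracket ?k ?l s"
    unfolding s using f g by (simp add: bracket_shift bij_bracket)
  finally show "bracket f ?m s = bracket ?k ?l s" .
qed

section \<open>Acyclicity\<close>

fun act :: "ldterm \<Rightarrow> state \<Rightarrow> state" where
  "act Var = id"
| "act (T \<triangleright> U) = bracket (act T) (act U)"

lemma bij_act: "bij (act T)"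
  by (induction T) (simp_all only: act.simps bij_id bij_bracket)

lemma act_ld_eq: "T =\<^sub>L\<^sub>D T' \<Longrightarrow> act T = act T'"
  by (induction rule: ld_eq.induct) (auto simp: bracket_selfdistributive bij_act)

text \<open>One left factor contributes \<open>g = shift (act U) \<circ> \<sigma>\<^sub>1 \<circ> (shift (act T1))\<^sup>-\<^sup>1\<close>, where only
  \<open>\<sigma>\<^sub>1\<close> touches the first entry of a sequence, and increases its first coordinate.\<close>

lemma act_left_subterm:
  assumes "subterm_at T' (replicate r False) = Some T" "r \<ge> 1"
  shows "\<exists>g. act T' = act T \<circ> g \<and> (\<forall>s. fst (s 0) < fst (g s 0))"
  using assms
proof (induction r arbitrary: T')
  case 0
  then show ?case by simp
next
  case (Suc r)
  from Suc.prems obtain T1 U where T': "T' = T1 \<triangleright> U"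
    and sub: "subterm_at T1 (replicate r False) = Some T" by (cases T') auto
  define g where "g = shift (act U) \<circ> sigma1 \<circ> inv (shift (act T1))"
  have T'g: "act T' = act T1 \<circ> g" by (simp add: T' g_def bracket_def o_assoc)
  have inv0: "inv (shift (act T1)) s 0 = s 0" for s
    by (metis bij_act bij_inv_eq_iff bij_shift shift_0)
  have incr: "fst (s 0) < fst (g s 0)" for s
    using sigma1_increasing[of "inv (shift (act T1)) s"] by (simp add: g_def inv0)
  show ?case
  proof (cases r)
    case 0
    then show ?thesis using T'g sub incr by auto
  next
    case (Suc r')
    with Suc.IH[OF sub] obtain g' where "act T1 = act T \<circ> g'" "\<And>s. fst (s 0) < fst (g' s 0)"
      by (metis One_nat_def Suc_le_mono zero_le)
    with T'g incr have "act T' = act T \<circ> (g' \<circ> g)" "\<And>s. fst (s 0) < fst ((g' \<circ> g) s 0)"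
      by (auto simp: o_assoc intro: less_trans)
    then show ?thesis by blast
  qed
qed

theorem ld_eq_acyclic:
  assumes "T \<sqsubset>\<^sup>* T'"
  shows "\<not> T =\<^sub>L\<^sub>D T'"
proof
  assume "T =\<^sub>L\<^sub>D T'"
  obtain g where g: "act T' = act T \<circ> g" "\<And>s. fst (s 0) < fst (g s 0)"
    using act_left_subterm assms unfolding iterated_left_subterm_def by blast
  fix s
  have "act T (g s) = act T s" using g(1) act_ld_eq[OF \<open>T =\<^sub>L\<^sub>D T'\<close>] by (metis comp_apply)
  then have "g s = s" using bij_act bij_is_inj injD by metis
  with g(2)[of s] show False by simp
qed

section \<open>Correctness of the algorithm\<close>

lemma ld_eq_verdict:
  assumes "T \<leadsto>\<^sup>* U" "T' \<leadsto>\<^sup>* U'"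
  shows "U = U' \<Longrightarrow> T =\<^sub>L\<^sub>D T'" and "U \<sqsubset>\<^sup>* U' \<or> U' \<sqsubset>\<^sup>* U \<Longrightarrow> \<not> T =\<^sub>L\<^sub>D T'"
  using assms ld_eq_acyclic expands_imp_ld_eq by (meson ld_eq.sym ld_eq.trans)+

lemma algorithm_A_from_correct:
  assumes "EXPAND T (fst (enum N)) = Some U" "EXPAND T' (snd (enum N)) = Some U'"
    and "U = U' \<or> U \<sqsubset>\<^sup>* U' \<or> U' \<sqsubset>\<^sup>* U" and "n \<le> N"
  shows "algorithm_A_from enum T T' n = Some (T =\<^sub>L\<^sub>D T')"
  using \<open>n \<le> N\<close>
proof (induction rule: inc_induct)
  case base
  show ?case
    using assms ld_eq_verdict[OF EXPAND_imp_expands EXPAND_imp_expands, OF assms(1,2)]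
    by (subst algorithm_A_from.simps) auto
next
  case (step n)
  show ?case
  proof (cases "EXPAND T (fst (enum n))"; cases "EXPAND T' (snd (enum n))")
    fix V V' assume V: "EXPAND T (fst (enum n)) = Some V" "EXPAND T' (snd (enum n)) = Some V'"
    then show ?thesis
      using step.IH ld_eq_verdict[OF EXPAND_imp_expands EXPAND_imp_expands, OF V]
      by (subst algorithm_A_from.simps) auto
  qed (use step.IH in \<open>subst algorithm_A_from.simps; simp\<close>)+
qed

theorem algorithm_A_correct:
  assumes "surj enum"
  shows "algorithm_A enum T T' = Some (T =\<^sub>L\<^sub>D T')"
proof -
  obtain U U' where U: "T \<leadsto>\<^sup>* U" "T' \<leadsto>\<^sup>* U'" "U = U' \<or> U \<sqsubset>\<^sup>* U' \<or> U' \<sqsubset>\<^sup>* U"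
    using comparison by blast
  obtain s s' where s: "EXPAND T s = Some U" "EXPAND T' s' = Some U'"
    using expands_imp_EXPAND U(1,2) by meson
  obtain N where N: "enum N = (s, s')" using assms by (metis surjD)
  show ?thesis
    unfolding algorithm_A_def
    by (rule algorithm_A_from_correct[where N = N, OF _ _ U(3)]) (simp_all add: N s)
qed

section \<open>Computable functions\<close>

text \<open>Total computable functions of \<open>k\<close> arguments. The argument is a list because the arity of a
  program is not reflected in a type.\<close>

definition computable :: "nat \<Rightarrow> (nat list \<Rightarrow> nat) \<Rightarrow> bool" where
  "computable k f \<longleftrightarrow> (\<exists>p. \<forall>xs. length xs = k \<longrightarrow> computes p xs (f xs))"

text \<open>The rules below have the form of introduction rules for functions \<open>\<lambda>xs. \<dots> xs \<dots>\<close> of the argument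
  list, so that computability of a defined function is proved by following its defining
  term.\<close>

lemma computable_compose:
  assumes f: "computable (length gs) f" and gs: "\<And>g. g \<in> set gs \<Longrightarrow> computable k g"
  shows "computable k (\<lambda>xs. f (map (\<lambda>g. g xs) gs))"
proof -
  obtain p where p: "\<And>ys. length ys = length gs \<Longrightarrow> computes p ys (f ys)"
    using f unfolding computable_def by blast
  obtain q where q: "\<And>g xs. g \<in> set gs \<Longrightarrow> length xs = k \<Longrightarrow> computes (q g) xs (g xs)"
    using gs unfolding computable_def by metis
  have "computes (Comp p (map q gs)) xs (f (map (\<lambda>g. g xs) gs))" if "length xs = k" for xs
    by (rule computes.comp[OF _ p]) (use that q in \<open>auto simp: list_all2_map1 list_all2_map2 list_all2_same\<close>)
  then show ?thesis unfolding computable_def by blast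
qed

lemma computable_compose1:
  assumes "computable 1 (\<lambda>xs. f (xs ! 0))" "computable k a"
  shows "computable k (\<lambda>xs. f (a xs))"
  using computable_compose[of "[a]" "\<lambda>xs. f (xs ! 0)" k] assms by simp

lemma computable_compose2:
  assumes "computable 2 (\<lambda>xs. f (xs ! 0) (xs ! 1))" "computable k a" "computable k b"
  shows "computable k (\<lambda>xs. f (a xs) (b xs))"
  using computable_compose[of "[a, b]" "\<lambda>xs. f (xs ! 0) (xs ! 1)" k] assms by (auto simp: numeral_2_eq_2)

lemma computable_compose3:
  assumes "computable 3 (\<lambda>xs. f (xs ! 0) (xs ! 1) (xs ! 2))" "computable k a" "computable k b" "computable k c"
  shows "computable k (\<lambda>xs. f (a xs) (b xs) (c xs))"
  using computable_compose[of "[a, b, c]" "\<lambda>xs. f (xs ! 0) (xs ! 1) (xs ! 2)" k] assms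
  by (auto simp: numeral_3_eq_3 numeral_2_eq_2)

named_theorems computable_intros

lemma computable_nth [computable_intros]: "i < k \<Longrightarrow> computable k (\<lambda>xs. xs ! i)"
  unfolding computable_def by (metis computes.proj)

lemma computable_Suc [computable_intros]:
  assumes "computable k a"
  shows "computable k (\<lambda>xs. Suc (a xs))"
proof (rule computable_compose1 [OF _ assms])
  have "computes Succ xs (Suc (xs ! 0))" if "length xs = 1" for xs
    using that computes.succ by (cases xs) auto
  then show "computable 1 (\<lambda>xs. Suc (xs ! 0))" unfolding computable_def by blast
qed

lemma computable_const [computable_intros]: "computable k (\<lambda>_. c)"
proof (induction c)
  case 0
  show ?case unfolding computable_def by (metis computes.zero)
qed (rule computable_Suc)

lemma computable_rec_nat:
  assumes g: "computable 2 (\<lambda>xs. g (xs ! 0) (xs ! 1))" and a: "computable k a"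
  shows "computable k (\<lambda>xs. rec_nat c g (a xs))"
proof (rule computable_compose1[OF _ a])
  obtain p where p: "computes p [n, y] (g n y)" for n y
  proof -
    from g obtain p where "\<forall>xs. length xs = 2 \<longrightarrow> computes p xs (g (xs ! 0) (xs ! 1))"
      unfolding computable_def by blast
    from this[rule_format, of "[_, _]"] show ?thesis by (intro that[of p]) simp
  qed
  \<comment> \<open>With one argument, the recursion starts from a program run on the empty list.\<close>
  obtain q where q: "computes q [] c"
    using computable_const[of 0 c] unfolding computable_def by auto
  have "computes (PrimRec q p) [n] (rec_nat c g n)" for n
    by (induction n) (auto intro: computes.primrec_0 computes.primrec_Suc p q)
  then have "computes (PrimRec q p) xs (rec_nat c g (xs ! 0))" if "length xs = 1" for xs
    using that by (cases xs) auto
  then show "computable 1 (\<lambda>xs. rec_nat c g (xs ! 0))" unfolding computable_def by blast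
qed

lemma computable_funpow:
  assumes f: "computable 1 (\<lambda>xs. f (xs ! 0))" and m: "computable k m" and a: "computable k a"
  shows "computable k (\<lambda>xs. (f ^^ m xs) (a xs))"
proof (rule computable_compose2[OF _ m a])
  obtain p where p: "computes p [x] (f x)" for x
  proof -
    from f obtain p where "\<forall>xs. length xs = 1 \<longrightarrow> computes p xs (f (xs ! 0))"
      unfolding computable_def by blast
    from this[rule_format, of "[_]"] show ?thesis by (intro that[of p]) simp
  qed
  have "computes (PrimRec (Proj 0) (Comp p [Proj 1])) [n, x] ((f ^^ n) x)" for n x
  proof (induction n)
    case 0
    show ?case using computes.proj[of 0 "[x]"] by (auto intro: computes.primrec_0)
  next
    case (Suc n)
    have "computes (Comp p [Proj 1]) [n, (f ^^ n) x, x] (f ((f ^^ n) x))"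
      using computes.proj[of 1 "[n, (f ^^ n) x, x]"]
      by (intro computes.comp[of _ _ "[(f ^^ n) x]"] p) simp
    with Suc show ?case by (auto intro: computes.primrec_Suc)
  qed
  then have "computes (PrimRec (Proj 0) (Comp p [Proj 1])) xs ((f ^^ (xs ! 0)) (xs ! 1))"
    if "length xs = 2" for xs
    using that by (auto simp: length_Suc_conv numeral_2_eq_2)
  then show "computable 2 (\<lambda>xs. (f ^^ (xs ! 0)) (xs ! 1))" unfolding computable_def by blast
qed

lemma computable_least:
  assumes "computable (Suc k) f" and ex: "\<And>xs. length xs = k \<Longrightarrow> \<exists>n. f (n # xs) = 0"
  shows "computable k (\<lambda>xs. LEAST n. f (n # xs) = 0)"
proof -
  obtain p where p: "\<And>n xs. length xs = k \<Longrightarrow> computes p (n # xs) (f (n # xs))"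
    using assms(1) unfolding computable_def by (metis length_Cons)
  have "computes (Mu p) xs (LEAST n. f (n # xs) = 0)" if xs: "length xs = k" for xs
  proof (rule computes.mu)
    show "computes p ((LEAST n. f (n # xs) = 0) # xs) 0"
      using p[OF xs] LeastI_ex[OF ex[OF xs]] by metis
    show "\<forall>i<LEAST n. f (n # xs) = 0. \<exists>y>0. computes p (i # xs) y"
      using p[OF xs] not_less_Least[of _ "\<lambda>n. f (n # xs) = 0"] by (metis not_gr_zero)
  qed
  then show ?thesis unfolding computable_def by blast
qed

lemma computable_if_zero:
  assumes c: "computable k c" and a: "computable k a" and b: "computable k b"
  shows "computable k (\<lambda>xs. if c xs = 0 then a xs else b xs)"
proof (rule computable_compose3[where f = "\<lambda>c a b. if c = 0 then a else b", OF _ c a b])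
  \<comment> \<open>The step program sees the predecessor, the previous value, \<open>x\<close> and \<open>y\<close>, and returns \<open>y\<close>.\<close>
  have "computes (PrimRec (Proj 0) (Proj 3)) [n, x, y] (if n = 0 then x else y)" for n x y
  proof (induction n)
    case 0
    show ?case using computes.proj[of 0 "[x, y]"] by (auto intro: computes.primrec_0)
  next
    case (Suc n)
    show ?case
      using Suc computes.proj[of 3 "[n, if n = 0 then x else y, x, y]"]
      by (auto intro: computes.primrec_Suc)
  qed
  note * = this
  have "computes (PrimRec (Proj 0) (Proj 3)) xs (if xs ! 0 = 0 then xs ! 1 else xs ! 2)"
    if len: "length xs = 3" for xs
  proof -
    obtain n x y where "xs = [n, x, y]"
      using len by (auto simp: length_Suc_conv numeral_3_eq_3)
    with *[of n x y] show ?thesis by (cases "n = 0") simp_all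
  qed
  then show "computable 3 (\<lambda>xs. if xs ! 0 = 0 then xs ! 1 else xs ! 2)"
    unfolding computable_def by blast
qed

lemma computable_pred [computable_intros]:
  assumes "computable k a"
  shows "computable k (\<lambda>xs. a xs - 1)"
proof -
  have "rec_nat 0 (\<lambda>n _. n) m = m - 1" for m by (cases m) simp_all
  moreover have "computable k (\<lambda>xs. rec_nat 0 (\<lambda>n _. n) (a xs))"
    by (intro computable_rec_nat computable_nth assms) simp
  ultimately show ?thesis by simp
qed

lemma computable_add [computable_intros]:
  assumes "computable k a" "computable k b"
  shows "computable k (\<lambda>xs. a xs + b xs)"
proof -
  have "(Suc ^^ m) n = m + n" for m n by (induction m) simp_all
  moreover have "computable k (\<lambda>xs. (Suc ^^ a xs) (b xs))"
    by (intro computable_funpow computable_intros assms) simp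
  ultimately show ?thesis by simp
qed

lemma computable_diff [computable_intros]:
  assumes "computable k a" "computable k b"
  shows "computable k (\<lambda>xs. a xs - b xs)"
proof -
  have "((\<lambda>n. n - 1) ^^ n) m = m - n" for m n by (induction n) simp_all
  moreover have "computable k (\<lambda>xs. ((\<lambda>n. n - 1) ^^ b xs) (a xs))"
    by (intro computable_funpow computable_intros assms) simp
  ultimately show ?thesis by simp
qed

lemma computable_if_eq [computable_intros]:
  assumes "computable k a" "computable k b" "computable k c" "computable k d"
  shows "computable k (\<lambda>xs. if a xs = b xs then c xs else d xs)"
proof -
  have "computable k (\<lambda>xs. if (a xs - b xs) + (b xs - a xs) = 0 then c xs else d xs)"
    using assms by (intro computable_if_zero computable_intros)
  moreover have "(a xs - b xs) + (b xs - a xs) = 0 \<longleftrightarrow> a xs = b xs" for xs by auto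
  ultimately show ?thesis by simp
qed

section \<open>Pairs of numbers as numbers\<close>

definition pair :: "nat \<Rightarrow> nat \<Rightarrow> nat" where "pair m n = prod_encode (m, n)"
definition pfst :: "nat \<Rightarrow> nat" where "pfst n = fst (prod_decode n)"
definition psnd :: "nat \<Rightarrow> nat" where "psnd n = snd (prod_decode n)"

lemma pair_simps [simp]: "pfst (pair m n) = m" "psnd (pair m n) = n"
    "pair m n = pair m' n' \<longleftrightarrow> m = m' \<and> n = n'"
  by (simp_all add: pair_def pfst_def psnd_def prod_encode_eq)

lemma pair_pfst_psnd [simp]: "pair (pfst n) (psnd n) = n"
  by (simp add: pair_def pfst_def psnd_def)

lemma pair_0_0: "pair 0 0 = 0"
  by (simp add: pair_def prod_encode_def)

lemma psnd_0: "pfst 0 = 0" "psnd 0 = 0"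
  using pair_simps[of 0 0] by (simp_all add: pair_0_0)

lemma computable_triangle [computable_intros]:
  assumes "computable k a"
  shows "computable k (\<lambda>xs. triangle (a xs))"
proof -
  have "rec_nat 0 (\<lambda>n y. y + Suc n) m = triangle m" for m by (induction m) simp_all
  moreover have "computable k (\<lambda>xs. rec_nat 0 (\<lambda>n y. y + Suc n) (a xs))"
    by (intro computable_rec_nat computable_intros assms) simp_all
  ultimately show ?thesis by simp
qed

text \<open>The index of the diagonal of \<open>\<nat> \<times> \<nat>\<close> on which the pair coded by \<open>n\<close> lies, that is, the sum of
  its components. Going through the codes in order, it increases exactly at triangular numbers,
  so a single primitive recursion computes it and both components follow by subtraction.\<close>

definition diagonal :: "nat \<Rightarrow> nat" where
  "diagonal = rec_nat 0 (\<lambda>n d. if Suc n = triangle (Suc d) then Suc d else d)"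

lemma diagonal_bounds: "triangle (diagonal n) \<le> n \<and> n < triangle (Suc (diagonal n))"
  by (induction n) (auto simp: diagonal_def)

lemma prod_decode_diagonal:
  "prod_decode n = (n - triangle (diagonal n), diagonal n - (n - triangle (diagonal n)))"
proof -
  let ?d = "diagonal n"
  have "prod_encode (n - triangle ?d, ?d - (n - triangle ?d)) = n"
    using diagonal_bounds[of n] by (simp add: prod_encode_def)
  then show ?thesis by (metis prod_encode_inverse)
qed

lemma computable_diagonal [computable_intros]:
  "computable k a \<Longrightarrow> computable k (\<lambda>xs. diagonal (a xs))"
  unfolding diagonal_def by (intro computable_rec_nat computable_intros) simp_all

lemma computable_pfst [computable_intros]: "computable k a \<Longrightarrow> computable k (\<lambda>xs. pfst (a xs))"
  and computable_psnd [computable_intros]: "computable k a \<Longrightarrow> computable k (\<lambda>xs. psnd (a xs))"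
  by (simp_all add: pfst_def psnd_def prod_decode_diagonal computable_intros)

lemma computable_pair [computable_intros]:
  "computable k a \<Longrightarrow> computable k b \<Longrightarrow> computable k (\<lambda>xs. pair (a xs) (b xs))"
  by (simp add: pair_def prod_encode_def computable_intros)

section \<open>Decidability by a search for derivations\<close>

lemma encode_term_Op: "encode_term (T \<triangleright> U) = Suc (pair (encode_term T) (encode_term U))"
  by (simp add: pair_def)

lemma encode_term_inject: "encode_term T = encode_term U \<longleftrightarrow> T = U"
proof (induction T arbitrary: U)
  case Var
  show ?case by (cases U) auto
next
  case (Op T1 T2)
  then show ?case by (cases U) (auto simp: prod_encode_eq)
qed

lemma surj_encode_term: "\<exists>T. encode_term T = n"
proof (induction n rule: less_induct)
  case (less n)
  show ?case
  proof (cases n)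
    case 0
    then show ?thesis by (metis encode_term.simps(1))
  next
    case (Suc m)
    have "pfst m \<le> m" "psnd m \<le> m"
      using le_prod_encode_1[of "pfst m" "psnd m"] le_prod_encode_2[of "psnd m" "pfst m"]
      by (simp_all flip: pair_def)
    then obtain T U where "encode_term T = pfst m" "encode_term U = psnd m"
      using less Suc by (metis le_imp_less_Suc)
    then have "encode_term (T \<triangleright> U) = n" by (simp add: Suc encode_term_Op del: encode_term.simps)
    then show ?thesis by blast
  qed
qed

text \<open>Derivations of equivalences are performed by a stack machine on numbers. A stack is a number
  whose first component is its top and whose second component is the rest of the stack; entries are
  pairs of codes of equivalent terms. Since \<open>0\<close> decodes to \<open>(0, 0)\<close> and codes \<open>Var\<close>, the
  number \<open>0\<close> is a bottomless stack of \<open>Var =\<^sub>L\<^sub>D Var\<close>, so that emptiness never has to be tested. Rule 0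
  pushes an instance of reflexivity, rule 1 an instance of selfdistributivity, rule 2 derives
  \<open>b = c\<close> from \<open>a = b\<close> and \<open>a = c\<close> (which gives both symmetry and transitivity), and every other rule
  number stands for congruence.\<close>

definition apply_inference :: "nat \<Rightarrow> nat \<Rightarrow> nat \<Rightarrow> nat" where
  "apply_inference rule t st =
    (if rule = 0 then pair (pair t t) st
     else if rule = 1 then
       pair (pair (Suc (pair (pfst t) (Suc (psnd t))))
         (Suc (pair (Suc (pair (pfst t) (pfst (psnd t)))) (Suc (pair (pfst t) (psnd (psnd t))))))) st
     else if rule = 2 then
       if pfst (pfst st) = pfst (pfst (psnd st))
       then pair (pair (psnd (pfst st)) (psnd (pfst (psnd st)))) (psnd (psnd st)) else st
     else
       pair (pair (Suc (pair (pfst (pfst st)) (pfst (pfst (psnd st)))))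
         (Suc (pair (psnd (pfst st)) (psnd (pfst (psnd st)))))) (psnd (psnd st)))"

text \<open>A machine state consists of a tape of instructions, read as an infinite sequence by repeated
  unpairing, and a stack. An instruction is a pair of a rule and a code of the terms it is instantiated
  with.\<close>

definition run_step :: "nat \<Rightarrow> nat" where
  "run_step s = pair (psnd (pfst s)) (apply_inference (pfst (pfst (pfst s))) (psnd (pfst (pfst s))) (psnd s))"

lemma computable_run_step: "computable k a \<Longrightarrow> computable k (\<lambda>xs. run_step (a xs))"
  unfolding run_step_def apply_inference_def by (intro computable_intros)

definition theorem_code :: "nat \<Rightarrow> bool" where
  "theorem_code p \<longleftrightarrow> (\<exists>T T'. p = pair (encode_term T) (encode_term T') \<and> T =\<^sub>L\<^sub>D T')"

definition valid_stack :: "nat \<Rightarrow> bool" where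
  "valid_stack st \<longleftrightarrow> (\<forall>i. theorem_code (pfst ((psnd ^^ i) st)))"

lemma valid_stack_pfst: "valid_stack st \<Longrightarrow> theorem_code (pfst st)"
  unfolding valid_stack_def by (metis funpow_0)

lemma valid_stack_psnd: "valid_stack st \<Longrightarrow> valid_stack (psnd st)"
  unfolding valid_stack_def by (metis comp_apply funpow_Suc_right)

lemma valid_stack_pair: "theorem_code p \<Longrightarrow> valid_stack st \<Longrightarrow> valid_stack (pair p st)"
  unfolding valid_stack_def
proof
  fix i assume "theorem_code p" "\<forall>i. theorem_code (pfst ((psnd ^^ i) st))"
  then show "theorem_code (pfst ((psnd ^^ i) (pair p st)))"
    by (cases i) (simp_all add: funpow_Suc_right del: funpow.simps)
qed

lemma valid_stack_0: "valid_stack 0"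
proof -
  have "(psnd ^^ i) 0 = 0" for i by (induction i) (simp_all add: psnd_0)
  moreover have "theorem_code 0"
    unfolding theorem_code_def by (metis encode_term.simps(1) ld_eq.refl pair_0_0)
  ultimately show ?thesis by (simp add: valid_stack_def psnd_0)
qed

text \<open>Every number is the code of a term, so a rule is sound with any number as its parameter.\<close>

lemma valid_stack_apply_inference:
  assumes st: "valid_stack st"
  shows "valid_stack (apply_inference rule t st)"
proof -
  obtain T1 T1' where T1: "pfst st = pair (encode_term T1) (encode_term T1')" "T1 =\<^sub>L\<^sub>D T1'"
    using valid_stack_pfst[OF st] unfolding theorem_code_def by blast
  obtain T2 T2' where T2: "pfst (psnd st) = pair (encode_term T2) (encode_term T2')" "T2 =\<^sub>L\<^sub>D T2'"
    using valid_stack_pfst[OF valid_stack_psnd[OF st]] unfolding theorem_code_def by blast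
  obtain T where T: "encode_term T = t" using surj_encode_term by blast
  obtain A B C where ABC: "encode_term A = pfst t" "encode_term B = pfst (psnd t)"
    "encode_term C = psnd (psnd t)" using surj_encode_term by meson
  have 0: "theorem_code (pair t t)"
    unfolding theorem_code_def T[symmetric] by (blast intro: ld_eq.refl)
  have 1: "theorem_code (pair (encode_term (A \<triangleright> (B \<triangleright> C))) (encode_term ((A \<triangleright> B) \<triangleright> (A \<triangleright> C))))"
    unfolding theorem_code_def by (blast intro: ld_eq.ld)
  have 2: "theorem_code (pair (encode_term T1') (encode_term T2'))" if "encode_term T1 = encode_term T2"
    using that T1(2) T2(2) unfolding theorem_code_def encode_term_inject by (blast intro: ld_eq.sym ld_eq.trans)
  have 3: "theorem_code (pair (encode_term (T1 \<triangleright> T2)) (encode_term (T1' \<triangleright> T2')))"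
    using T1(2) T2(2) unfolding theorem_code_def by (blast intro: ld_eq.cong)
  show ?thesis
    using 0 1 2 3 valid_stack_psnd[OF valid_stack_psnd[OF st]] st
    by (auto simp: apply_inference_def T1(1) T2(1) encode_term_Op ABC simp del: encode_term.simps
        intro!: valid_stack_pair)
qed

lemma valid_stack_run: "valid_stack (psnd s) \<Longrightarrow> valid_stack (psnd ((run_step ^^ n) s))"
  by (induction n) (simp_all add: run_step_def valid_stack_apply_inference)

definition leads_to :: "nat list \<Rightarrow> nat \<Rightarrow> nat \<Rightarrow> bool" where
  "leads_to ks st st' \<longleftrightarrow>
    (\<forall>tape. (run_step ^^ length ks) (pair (foldr pair ks tape) st) = pair tape st')"

lemma leads_to_append: "leads_to ks st st' \<Longrightarrow> leads_to js st' st'' \<Longrightarrow> leads_to (ks @ js) st st''"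
  unfolding leads_to_def length_append add.commute[of "length ks"] funpow_add by simp

lemma leads_to_single: "leads_to [pair rule t] st (apply_inference rule t st)"
  by (simp add: leads_to_def run_step_def)

text \<open>The rules of \<open>=\<^sub>L\<^sub>D\<close> are replayed one by one. For symmetry, \<open>T = T\<close> is pushed below \<open>T = T'\<close>, and rule 2
  turns the two into \<open>T' = T\<close>; transitivity continues with rule 2 on \<open>T' = T\<close> and \<open>T' = T''\<close>. The
  premise that is needed last is derived first.\<close>

lemma ld_eq_derivable:
  "T =\<^sub>L\<^sub>D T' \<Longrightarrow> \<exists>ks. \<forall>st. leads_to ks st (pair (pair (encode_term T) (encode_term T')) st)"
proof (induction rule: ld_eq.induct)
  case (ld T1 T2 T3)
  have "apply_inference 1 (pair (encode_term T1) (pair (encode_term T2) (encode_term T3))) st =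
     pair (pair (encode_term (T1 \<triangleright> (T2 \<triangleright> T3))) (encode_term ((T1 \<triangleright> T2) \<triangleright> (T1 \<triangleright> T3)))) st" for st
    by (simp add: apply_inference_def encode_term_Op del: encode_term.simps)
  then show ?case by (metis leads_to_single)
next
  case (refl T)
  have "apply_inference 0 (encode_term T) st = pair (pair (encode_term T) (encode_term T)) st" for st
    by (simp add: apply_inference_def)
  then show ?case by (metis leads_to_single)
next
  case (sym T T')
  then obtain ks where ks: "\<And>st. leads_to ks st (pair (pair (encode_term T) (encode_term T')) st)" by blast
  let ?t = "encode_term T" and ?t' = "encode_term T'"
  have "leads_to ([pair 0 ?t] @ ks @ [pair 2 0]) st (pair (pair ?t' ?t) st)" for st
  proof (intro leads_to_append)
    show "leads_to [pair 0 ?t] st (pair (pair ?t ?t) st)"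
      using leads_to_single[of 0 ?t st] by (simp add: apply_inference_def)
    show "leads_to ks (pair (pair ?t ?t) st) (pair (pair ?t ?t') (pair (pair ?t ?t) st))"
      by (rule ks)
    show "leads_to [pair 2 0] (pair (pair ?t ?t') (pair (pair ?t ?t) st)) (pair (pair ?t' ?t) st)"
      using leads_to_single[of 2 0 "pair (pair ?t ?t') (pair (pair ?t ?t) st)"] by (simp add: apply_inference_def)
  qed
  then show ?case by blast
next
  case (trans T T' T'')
  let ?t = "encode_term T" and ?t' = "encode_term T'" and ?t'' = "encode_term T''"
  from trans obtain ks js where ks: "\<And>st. leads_to ks st (pair (pair ?t ?t') st)"
    and js: "\<And>st. leads_to js st (pair (pair ?t' ?t'') st)" by blast
  have "leads_to (js @ [pair 0 ?t] @ ks @ [pair 2 0] @ [pair 2 0]) st (pair (pair ?t ?t'') st)" for st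
  proof (intro leads_to_append)
    let ?st = "pair (pair ?t' ?t'') st"
    show "leads_to js st ?st" by (rule js)
    show "leads_to [pair 0 ?t] ?st (pair (pair ?t ?t) ?st)"
      using leads_to_single[of 0 ?t ?st] by (simp add: apply_inference_def)
    show "leads_to ks (pair (pair ?t ?t) ?st) (pair (pair ?t ?t') (pair (pair ?t ?t) ?st))"
      by (rule ks)
    show "leads_to [pair 2 0] (pair (pair ?t ?t') (pair (pair ?t ?t) ?st)) (pair (pair ?t' ?t) ?st)"
      using leads_to_single[of 2 0 "pair (pair ?t ?t') (pair (pair ?t ?t) ?st)"] by (simp add: apply_inference_def)
    show "leads_to [pair 2 0] (pair (pair ?t' ?t) ?st) (pair (pair ?t ?t'') st)"
      using leads_to_single[of 2 0 "pair (pair ?t' ?t) ?st"] by (simp add: apply_inference_def)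
  qed
  then show ?case by blast
next
  case (cong T1 T1' T2 T2')
  let ?p1 = "pair (encode_term T1) (encode_term T1')" and ?p2 = "pair (encode_term T2) (encode_term T2')"
  from cong obtain ks js where ks: "\<And>st. leads_to ks st (pair ?p1 st)"
    and js: "\<And>st. leads_to js st (pair ?p2 st)" by blast
  have "leads_to (js @ ks @ [pair 3 0]) st
    (pair (pair (encode_term (T1 \<triangleright> T2)) (encode_term (T1' \<triangleright> T2'))) st)" for st
  proof (intro leads_to_append)
    show "leads_to js st (pair ?p2 st)" by (rule js)
    show "leads_to ks (pair ?p2 st) (pair ?p1 (pair ?p2 st))" by (rule ks)
    show "leads_to [pair 3 0] (pair ?p1 (pair ?p2 st))
       (pair (pair (encode_term (T1 \<triangleright> T2)) (encode_term (T1' \<triangleright> T2'))) st)"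
      using leads_to_single[of 3 0 "pair ?p1 (pair ?p2 st)"]
      by (simp add: apply_inference_def encode_term_Op del: encode_term.simps)
  qed
  then show ?case by blast
qed

definition left_code :: "nat \<Rightarrow> nat" where "left_code t = pfst (t - 1)"

lemma left_code_0: "left_code 0 = 0"
  by (simp add: left_code_def psnd_0)

text \<open>The test that the left subterm of \<open>t'\<close> at depth \<open>r + 1\<close> is \<open>t\<close>. The code \<open>0\<close> of \<open>Var\<close>
  is a fixed point of \<open>left_code\<close>, so it has to be excluded that the descent has left the
  term.\<close>

definition left_subterm_test :: "nat \<Rightarrow> nat \<Rightarrow> nat \<Rightarrow> nat" where
  "left_subterm_test r t t' =
    (if (left_code ^^ r) t' = 0 then 0 else if left_code ((left_code ^^ r) t') = t then 1 else 0)"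

lemma computable_left_subterm_test [computable_intros]:
  assumes "computable k a" "computable k b" "computable k c"
  shows "computable k (\<lambda>xs. left_subterm_test (a xs) (b xs) (c xs))"
proof -
  have left: "computable k (\<lambda>xs. left_code (a xs))" if "computable k a" for k a
    unfolding left_code_def using that by (intro computable_intros)
  show ?thesis
    unfolding left_subterm_test_def
    by (intro computable_intros computable_funpow left assms) simp_all
qed

lemma left_code_funpow:
  "subterm_at T (replicate r False) = Some U \<Longrightarrow> (left_code ^^ r) (encode_term T) = encode_term U"
proof (induction r arbitrary: T)
  case (Suc r)
  then obtain T1 T2 where "T = T1 \<triangleright> T2" by (cases T) auto
  with Suc show ?case
    by (simp add: funpow_Suc_right left_code_def encode_term_Op del: funpow.simps encode_term.simps)
qed simp

lemma left_code_funpow_defined: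
  "(left_code ^^ r) (encode_term T) \<noteq> 0 \<Longrightarrow> \<exists>U. subterm_at T (replicate r False) = Some U"
proof (induction r arbitrary: T)
  case (Suc r)
  have "(left_code ^^ n) 0 = 0" for n by (induction n) (simp_all add: left_code_0)
  with Suc.prems obtain T1 T2 where T: "T = T1 \<triangleright> T2" by (cases T) (auto simp: left_code_0)
  have "left_code (encode_term T) = encode_term T1"
    by (simp add: T left_code_def encode_term_Op del: encode_term.simps)
  with Suc show ?case by (simp add: T funpow_Suc_right del: funpow.simps encode_term.simps)
qed simp

lemma replicate_snoc: "replicate (Suc n) x = replicate n x @ [x]"
  by (simp add: replicate_append_same)

lemma left_subterm_test_imp:
  assumes "left_subterm_test r (encode_term T) (encode_term T') \<noteq> 0"
  shows "T \<sqsubset>\<^sup>* T'"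
proof -
  have nz: "(left_code ^^ r) (encode_term T') \<noteq> 0"
    and eq: "left_code ((left_code ^^ r) (encode_term T')) = encode_term T"
    using assms by (auto simp: left_subterm_test_def split: if_splits)
  then obtain U where U: "subterm_at T' (replicate r False) = Some U"
    using left_code_funpow_defined by blast
  with nz eq left_code_funpow[OF U] obtain U1 U2 where "U = U1 \<triangleright> U2" "U1 = T"
    by (cases U) (auto simp: left_code_def encode_term_Op encode_term_inject simp del: encode_term.simps(2))
  then have "subterm_at T' (replicate (Suc r) False) = Some T"
    using U by (simp add: replicate_snoc subterm_at_append del: replicate.simps)
  then show ?thesis unfolding iterated_left_subterm_def by (metis le_add1 plus_1_eq_Suc)
qed

lemma imp_left_subterm_test:
  assumes "T \<sqsubset>\<^sup>* T'"
  shows "\<exists>r. left_subterm_test r (encode_term T) (encode_term T') \<noteq> 0"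
proof -
  obtain r where r: "subterm_at T' (replicate (Suc r) False) = Some T"
    using assms unfolding iterated_left_subterm_def by (metis One_nat_def Suc_le_D)
  then obtain U where U: "subterm_at T' (replicate r False) = Some U" "subterm_at U [False] = Some T"
    by (auto simp: replicate_snoc subterm_at_append bind_eq_Some_conv simp del: replicate.simps)
  then obtain U2 where "U = T \<triangleright> U2" by (cases U) auto
  with left_code_funpow[OF U(1)] have "left_subterm_test r (encode_term T) (encode_term T') = 1"
    by (simp add: left_subterm_test_def left_code_def encode_term_Op del: encode_term.simps)
  then show ?thesis by (metis one_neq_zero)
qed

definition final_stack :: "nat \<Rightarrow> nat" where
  "final_stack n = psnd ((run_step ^^ pfst n) (pair (psnd n) 0))"

definition compare_codes :: "nat \<Rightarrow> nat \<Rightarrow> nat \<Rightarrow> nat" where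
  "compare_codes r u u' =
    (if u = u' then 2 else if left_subterm_test r u u' = 1 then 1 else left_subterm_test r u' u)"

lemma compare_codes_nonzero_iff:
  "compare_codes r u u' \<noteq> 0 \<longleftrightarrow>
    u = u' \<or> left_subterm_test r u u' \<noteq> 0 \<or> left_subterm_test r u' u \<noteq> 0"
  by (auto simp: compare_codes_def left_subterm_test_def)

text \<open>The number \<open>n\<close> codes a number of machine steps, a tape and a depth. If the resulting stack has
  entries \<open>t = u\<close> and \<open>t' = u'\<close> on top, then \<open>u\<close> and \<open>u'\<close> are compared: 2 means that they are equal, 1
  that one is an iterated left subterm of the other. Value 0 means that \<open>n\<close> is inconclusive.\<close>

definition verdict :: "nat \<Rightarrow> nat \<Rightarrow> nat \<Rightarrow> nat" where
  "verdict n t t' =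
    (if pfst (pfst (final_stack (pfst n))) = t then
       if pfst (pfst (psnd (final_stack (pfst n)))) = t' then
         compare_codes (psnd n) (psnd (pfst (final_stack (pfst n)))) (psnd (pfst (psnd (final_stack (pfst n)))))
       else 0
     else 0)"

lemma computable_final_stack [computable_intros]:
  "computable k a \<Longrightarrow> computable k (\<lambda>xs. final_stack (a xs))"
  unfolding final_stack_def
  by (intro computable_intros computable_funpow computable_run_step) simp_all

lemma computable_verdict [computable_intros]:
  "computable k a \<Longrightarrow> computable k b \<Longrightarrow> computable k c \<Longrightarrow> computable k (\<lambda>xs. verdict (a xs) (b xs) (c xs))"
  unfolding verdict_def compare_codes_def by (intro computable_intros)

lemma verdict_sound:
  assumes "verdict n (encode_term T) (encode_term T') \<noteq> 0"
  shows "verdict n (encode_term T) (encode_term T') = (if T =\<^sub>L\<^sub>D T' then 2 else 1)"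
proof -
  have st: "valid_stack (final_stack (pfst n))"
    unfolding final_stack_def by (rule valid_stack_run) (simp add: valid_stack_0)
  have c: "pfst (pfst (final_stack (pfst n))) = encode_term T"
    "pfst (pfst (psnd (final_stack (pfst n)))) = encode_term T'"
    using assms by (auto simp: verdict_def split: if_splits)
  obtain U where U: "pfst (final_stack (pfst n)) = pair (encode_term T) (encode_term U)" "T =\<^sub>L\<^sub>D U"
    using valid_stack_pfst[OF st] c unfolding theorem_code_def by (auto simp: encode_term_inject)
  obtain U' where U': "pfst (psnd (final_stack (pfst n))) = pair (encode_term T') (encode_term U')" "T' =\<^sub>L\<^sub>D U'"
    using valid_stack_pfst[OF valid_stack_psnd[OF st]] c unfolding theorem_code_def
    by (auto simp: encode_term_inject)
  let ?u = "encode_term U" and ?u' = "encode_term U'"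
  have v: "verdict n (encode_term T) (encode_term T') = compare_codes (psnd n) ?u ?u'"
    by (simp add: verdict_def U U')
  show ?thesis
  proof (cases "U = U'")
    case True
    with U U' have "T =\<^sub>L\<^sub>D T'" by (blast intro: ld_eq.sym ld_eq.trans)
    with True show ?thesis by (simp add: v compare_codes_def)
  next
    case False
    then have ne: "?u \<noteq> ?u'" by (simp add: encode_term_inject)
    with assms v have "left_subterm_test (psnd n) ?u ?u' \<noteq> 0 \<or> left_subterm_test (psnd n) ?u' ?u \<noteq> 0"
      by (metis compare_codes_nonzero_iff)
    then have "U \<sqsubset>\<^sup>* U' \<or> U' \<sqsubset>\<^sup>* U" using left_subterm_test_imp by blast
    then have "\<not> U =\<^sub>L\<^sub>D U'" using ld_eq_acyclic ld_eq.sym by blast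
    with U U' have "\<not> T =\<^sub>L\<^sub>D T'" by (blast intro: ld_eq.sym ld_eq.trans)
    moreover have "compare_codes (psnd n) ?u ?u' = 1"
      using assms ne unfolding v by (auto simp: compare_codes_def left_subterm_test_def split: if_splits)
    ultimately show ?thesis by (simp add: v)
  qed
qed

lemma verdict_complete: "\<exists>n. verdict n (encode_term T) (encode_term T') \<noteq> 0"
proof -
  obtain U U' where U: "T =\<^sub>L\<^sub>D U" "T' =\<^sub>L\<^sub>D U'" and cmp: "U = U' \<or> U \<sqsubset>\<^sup>* U' \<or> U' \<sqsubset>\<^sup>* U"
    using comparison expands_imp_ld_eq by blast
  let ?p = "pair (encode_term T) (encode_term U)" and ?p' = "pair (encode_term T') (encode_term U')"
  obtain ks js where "\<And>st. leads_to ks st (pair ?p st)" "\<And>st. leads_to js st (pair ?p' st)"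
    using U ld_eq_derivable by meson
  then have "leads_to (js @ ks) 0 (pair ?p (pair ?p' 0))" by (blast intro: leads_to_append)
  then have st: "final_stack (pair (length (js @ ks)) (foldr pair (js @ ks) 0)) = pair ?p (pair ?p' 0)"
    by (simp add: final_stack_def leads_to_def)
  obtain r where r: "compare_codes r (encode_term U) (encode_term U') \<noteq> 0"
    using cmp imp_left_subterm_test unfolding compare_codes_nonzero_iff by metis
  have "verdict (pair (pair (length (js @ ks)) (foldr pair (js @ ks) 0)) r) (encode_term T) (encode_term T') \<noteq> 0"
    using r by (simp add: verdict_def st del: foldr_append length_append)
  then show ?thesis by blast
qed

theorem decidable_ld_eq: "decidable_relation (=\<^sub>L\<^sub>D)"
proof -
  let ?n = "\<lambda>xs. LEAST n. (if verdict n (xs ! 0) (xs ! 1) = 0 then 1 else 0) = (0::nat)"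
  have "computable 2 ?n"
  proof -
    have "computable (Suc 2) (\<lambda>xs. if verdict (xs ! 0) (xs ! 1) (xs ! 2) = 0 then 1 else 0)"
      by (intro computable_intros) simp_all
    moreover have "\<exists>n. (if verdict n (xs ! 0) (xs ! 1) = 0 then 1 else 0) = (0::nat)" for xs
      using verdict_complete surj_encode_term by (metis (full_types))
    ultimately show ?thesis
      using computable_least[of 2 "\<lambda>xs. if verdict (xs ! 0) (xs ! 1) (xs ! 2) = 0 then 1 else 0"]
      by (simp add: numeral_2_eq_2)
  qed
  then have "computable 2 (\<lambda>xs. verdict (?n xs) (xs ! 0) (xs ! 1) - 1)"
    by (intro computable_intros) simp_all
  then obtain p where p: "\<And>xs. length xs = 2 \<Longrightarrow> computes p xs (verdict (?n xs) (xs ! 0) (xs ! 1) - 1)"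
    unfolding computable_def by blast
  have "computes p [encode_term T, encode_term T'] (if T =\<^sub>L\<^sub>D T' then 1 else 0)" for T T'
  proof -
    let ?xs = "[encode_term T, encode_term T']"
    have "verdict (?n ?xs) (encode_term T) (encode_term T') \<noteq> 0"
      using LeastI_ex[OF verdict_complete[of T T']] by (simp add: if_distrib[of "\<lambda>n. n = 0"])
    from verdict_sound[OF this] show ?thesis using p[of ?xs] by (auto split: if_splits)
  qed
  then show ?thesis unfolding decidable_relation_def by blast
qed

theorem corollary2p18:
  "(\<forall>enum. computable_enumeration enum \<and> surj enum \<longrightarrow>
      (\<forall>T T'. algorithm_A enum T T' = Some (if T =\<^sub>L\<^sub>D T' then True else False)))
   \<and> decidable_relation (=\<^sub>L\<^sub>D)"
  by (simp add: algorithm_A_correct decidable_ld_eq)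

end
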